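(* Let $\Sigma$ be a Riemann surface, let $\varphi:\Sigma\to S^6\subset\mathbb{R}^7$ be a conformal harmonic immersion and let $F:\Sigma\to\mathbb{R}^7$ be such that $dF=\varphi\times *d\varphi$. Then $F$ is minimal in some hypersphere of $\mathbb{R}^7$ if, and only if, up to change of orientation of $\Sigma$, one of the following statements holds: (1) $\varphi$ is an almost complex curve; (2) there exist a unit vector $\mathbf{v}\in\mathbb{R}^7$, an angle $\beta$ and an almost complex curve $\tilde\varphi$ of type (III), with $\tilde\varphi(\Sigma)\subset S^5=S^6\cap\mathbf{v}^\perp$, such that $\varphi=R_{\mathbf{v}}(\beta)\tilde\varphi$; (3) $\varphi$ is totally geodesic.
   Context: $\times$ is the $7$-dimensional cross product on $\mathbb{R}^7$: the bilinear antisymmetric product with $\mathbf{e}_i\times\mathbf{e}_j=\mathbf{e}_k$ for $(i,j,k)$ equal to, or a cyclic permutation of, one of $(1,2,3),(1,4,5),(1,7,6),(2,4,6),(2,5,7),(3,4,7),(3,6,5)$. $S^6$ is the unit sphere of $\mathbb{R}^7$. With a local conformal coordinate $z=x+iy$ on $\Sigma$, $dF=\varphi\times *d\varphi$ means $F_x=\varphi\times\varphi_y$, $F_y=-\varphi\times\varphi_x$. (The form $\varphi\times *d\varphi$ is closed when $\varphi$ is harmonic, so $F$ exists if $\Sigma$ is simply connected, and it is unique up to an additive constant.) An almost complex curve is a non-constant smooth map $\varphi:\Sigma\to S^6$ whose differential is complex linear with respect to the nearly Kähler structure $J\mathbf{u}=\mathbf{x}\times\mathbf{u}$ ($\mathbf{u}\in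 T_{\mathbf{x}}S^6$), i.e. $\varphi_y=\varphi\times\varphi_x$. It is of type (III) if it is linearly full in some totally geodesic $S^5$ in $S^6$ (i.e. its image lies in $S^6\cap U$ for some $6$-dimensional linear subspace $U$ and in no smaller linear subspace). For a unit vector $\mathbf{v}$ and an angle $\beta$, $R_{\mathbf{v}}(\beta)\in SO(7)$ is the rotation with $R_{\mathbf{v}}(\beta)\mathbf{v}=\mathbf{v}$ and $R_{\mathbf{v}}(\beta)\mathbf{x}=\cos\beta\,\mathbf{x}+\sin\beta\,\mathbf{v}\times\mathbf{x}$ for $\mathbf{x}\in S^6\cap\mathbf{v}^\perp$. "Up to change of orientation of $\Sigma$" means after possibly replacing the complex structure of $\Sigma$ by the conjugate one. *)

theory Defs
  imports "HOL-Analysis.Analysis"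
begin

section \<open>The cross product of \<open>\<real>\<^sup>7\<close>\<close>

text \<open>The index type \<^typ>\<open>7\<close> is arithmetic modulo 7, so the index 7 is the element 0;
  this is harmless, the seven numerals 1, \<dots>, 7 denote the seven distinct indices.\<close>

definition cross7_triples :: "(7 \<times> 7 \<times> 7) list" where
  "cross7_triples =
     [(1, 2, 3), (1, 4, 5), (1, 7, 6), (2, 4, 6), (2, 5, 7), (3, 4, 7), (3, 6, 5)]"

text \<open>The bilinear antisymmetric extension of \<open>e\<^sub>i \<times> e\<^sub>j = e\<^sub>k\<close>, for \<open>(i, j, k)\<close> ranging over
  the triples above and their cyclic permutations.\<close>

definition cross7 :: "real^7 \<Rightarrow> real^7 \<Rightarrow> real^7" where
  "cross7 x y = (\<Sum>(i, j, k) \<leftarrow> cross7_triples.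
       (x $ i * y $ j - x $ j * y $ i) *\<^sub>R axis k 1
     + (x $ j * y $ k - x $ k * y $ j) *\<^sub>R axis i 1
     + (x $ k * y $ i - x $ i * y $ k) *\<^sub>R axis j 1)"

lemma linear_cross7: "linear (cross7 x)"
proof -
  define f where "f t y = (case t of (i, j, k) \<Rightarrow>
       (x $ i * y $ j - x $ j * y $ i) *\<^sub>R axis k (1::real)
     + (x $ j * y $ k - x $ k * y $ j) *\<^sub>R axis i 1
     + (x $ k * y $ i - x $ i * y $ k) *\<^sub>R axis j 1)" for t :: "7 \<times> 7 \<times> 7" and y :: "real^7"
  have "linear (\<lambda>y. (x $ i * y $ j - x $ j * y $ i) *\<^sub>R axis k (1::real))" for i j k :: 7
    by (rule linearI) (simp_all add: algebra_simps)
  then have "linear (f t)" for t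
    unfolding f_def by (cases t) (simp add: linear_compose_add)
  then have "linear (\<lambda>y. \<Sum>t\<leftarrow>ts. f t y)" for ts
    by (induction ts) (auto intro: linear_compose_add linear_zero)
  moreover have "cross7 x = (\<lambda>y. \<Sum>t\<leftarrow>cross7_triples. f t y)"
    by (simp add: fun_eq_iff cross7_def f_def)
  ultimately show ?thesis
    by simp
qed

lemma cross7_antisym: "cross7 x y = - cross7 y x"
proof -
  have "(x $ i * y $ j - x $ j * y $ i) *\<^sub>R axis k (1::real)
      = - ((y $ i * x $ j - y $ j * x $ i) *\<^sub>R axis k 1)" for i j k :: 7
    by (simp add: mult.commute flip: scaleR_minus_left)
  then show ?thesis
    unfolding cross7_def uminus_sum_list_map o_def split_def by simp
qed

lemma bilinear_cross7: "bilinear cross7"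
proof -
  have "linear (\<lambda>x. cross7 x y)" for y
    using linear_compose_neg[OF linear_cross7[of y]] by (simp flip: cross7_antisym)
  then show ?thesis
    by (simp add: bilinear_def linear_cross7)
qed

lemma cross7_axis:
  assumes "(i, j, k) \<in> set cross7_triples"
  shows "cross7 (axis i 1) (axis j 1) = axis k 1"
    and "cross7 (axis j 1) (axis k 1) = axis i 1"
    and "cross7 (axis k 1) (axis i 1) = axis j 1"
proof -
  have nth: "axis m (1::real) $ n = (if n = m then 1 else 0)" for m n :: 7
    by (simp add: axis_def)
  have "(i, j, k) \<in> {(1, 2, 3), (1, 4, 5), (1, 7, 6), (2, 4, 6), (2, 5, 7), (3, 4, 7), (3, 6, 5)}"
    using assms by (simp add: cross7_triples_def)
  then show "cross7 (axis i 1) (axis j 1) = axis k 1"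
    and "cross7 (axis j 1) (axis k 1) = axis i 1"
    and "cross7 (axis k 1) (axis i 1) = axis j 1"
    by (elim insertE emptyE; simp only: prod.inject; elim conjE; simp add: cross7_triples_def cross7_def nth)+
qed

text \<open>The linear map that fixes \<open>v\<close> and sends \<open>x\<close> to \<open>cos \<beta> x + sin \<beta> (v \<times> x)\<close> for \<open>x\<close>
  orthogonal to \<open>v\<close>, where \<open>v\<close> is a unit vector.\<close>

definition rot7 :: "real^7 \<Rightarrow> real \<Rightarrow> real^7 \<Rightarrow> real^7" where
  "rot7 v \<beta> x =
     (x \<bullet> v) *\<^sub>R v + cos \<beta> *\<^sub>R (x - (x \<bullet> v) *\<^sub>R v) + sin \<beta> *\<^sub>R cross7 v x"


section \<open>Smooth functions\<close>

primrec Ck_on :: "nat \<Rightarrow> ('a::real_normed_vector \<Rightarrow> 'b::real_normed_vector) \<Rightarrow> 'a set \<Rightarrow> bool" where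
  "Ck_on 0 f S \<longleftrightarrow> continuous_on S f"
| "Ck_on (Suc n) f S \<longleftrightarrow> (\<forall>x\<in>S. f differentiable at x) \<and>
     (\<forall>h. Ck_on n (\<lambda>x. frechet_derivative f (at x) h) S)"

definition smooth_on :: "('a::real_normed_vector \<Rightarrow> 'b::real_normed_vector) \<Rightarrow> 'a set \<Rightarrow> bool" where
  "smooth_on f S \<longleftrightarrow> (\<forall>n. Ck_on n f S)"


section \<open>Riemann surfaces\<close>

text \<open>A chart is a pair of its domain and the coordinate function, whose values outside the
  domain are irrelevant. Second countability is not required: it is automatic for connected
  surfaces with a holomorphic atlas.\<close>

type_synonym 'a chart = "'a set \<times> ('a \<Rightarrow> complex)"

locale riemann_surface =
  fixes A :: "('a::t2_space) chart set"
  assumes connected: "connected (UNIV :: 'a set)"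
    and covering: "(\<Union>(U, z)\<in>A. U) = UNIV"
    and chart_open: "(U, z) \<in> A \<Longrightarrow> open U"
    and chart_image_open: "(U, z) \<in> A \<Longrightarrow> open (z ` U)"
    and chart_homeomorphism: "(U, z) \<in> A \<Longrightarrow> homeomorphism U (z ` U) z (inv_into U z)"
    and transition_holomorphic:
      "(U, z) \<in> A \<Longrightarrow> (V, w) \<in> A \<Longrightarrow> (w \<circ> inv_into U z) holomorphic_on z ` (U \<inter> V)"

text \<open>The atlas of the conjugate complex structure.\<close>

definition conj_atlas :: "'a chart set \<Rightarrow> 'a chart set" where
  "conj_atlas A = (\<lambda>(U, z). (U, cnj \<circ> z)) ` A"

text \<open>\<open>everywhere_local A P f\<close>: the condition \<open>P\<close> holds for the coordinate expression of \<open>f\<close> in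
  each chart of the atlas, at each point of the image of the chart.\<close>

definition everywhere_local ::
    "'a chart set \<Rightarrow> ((complex \<Rightarrow> 'b) \<Rightarrow> complex \<Rightarrow> bool) \<Rightarrow> ('a \<Rightarrow> 'b) \<Rightarrow> bool" where
  "everywhere_local A P f \<longleftrightarrow> (\<forall>(U, z)\<in>A. \<forall>p\<in>z ` U. P (f \<circ> inv_into U z) p)"

definition smooth_map :: "'a chart set \<Rightarrow> ('a \<Rightarrow> 'b::real_normed_vector) \<Rightarrow> bool" where
  "smooth_map A f \<longleftrightarrow> (\<forall>(U, z)\<in>A. smooth_on (f \<circ> inv_into U z) (z ` U))"


section \<open>Differential geometry in a conformal coordinate \<open>x + \<i>y\<close>\<close>

abbreviation pdx :: "(complex \<Rightarrow> 'b::real_normed_vector) \<Rightarrow> complex \<Rightarrow> 'b" where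
  "pdx g p \<equiv> frechet_derivative g (at p) 1"

abbreviation pdy :: "(complex \<Rightarrow> 'b::real_normed_vector) \<Rightarrow> complex \<Rightarrow> 'b" where
  "pdy g p \<equiv> frechet_derivative g (at p) \<i>"

definition immersion :: "'a chart set \<Rightarrow> ('a \<Rightarrow> 'b::real_normed_vector) \<Rightarrow> bool" where
  "immersion A f \<longleftrightarrow> smooth_map A f \<and>
     everywhere_local A (\<lambda>g p. inj (frechet_derivative g (at p))) f"

definition conformal :: "'a chart set \<Rightarrow> ('a \<Rightarrow> 'b::real_inner) \<Rightarrow> bool" where
  "conformal A f \<longleftrightarrow> everywhere_local A
     (\<lambda>g p. norm (pdx g p) = norm (pdy g p) \<and> pdx g p \<bullet> pdy g p = 0) f"

definition laplacian :: "(complex \<Rightarrow> 'b::real_normed_vector) \<Rightarrow> complex \<Rightarrow> 'b" where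
  "laplacian g p = pdx (pdx g) p + pdy (pdy g) p"

text \<open>Up to a positive conformal factor, the tension field of a map into the unit sphere is the
  component of its coordinate Laplacian that is tangent to the sphere.\<close>

definition harmonic_into_unit_sphere :: "'a chart set \<Rightarrow> ('a \<Rightarrow> 'b::real_inner) \<Rightarrow> bool" where
  "harmonic_into_unit_sphere A f \<longleftrightarrow> smooth_map A f \<and> range f \<subseteq> sphere 0 1 \<and>
     everywhere_local A (\<lambda>g p. laplacian g p - (laplacian g p \<bullet> g p) *\<^sub>R g p = 0) f"

text \<open>The component of \<open>v\<close> in the orthogonal complement of the span of \<open>B\<close>.\<close>

definition normal_part :: "'b::euclidean_space set \<Rightarrow> 'b \<Rightarrow> 'b" where
  "normal_part B v = (THE n. (\<forall>b\<in>B. n \<bullet> b = 0) \<and> v - n \<in> span B)"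

text \<open>The second fundamental form, at \<open>p\<close> and for the coordinate directions \<open>h\<close> and \<open>k\<close>, of an
  immersion \<open>g\<close> into a hypersphere with centre \<open>c\<close>: the component of the second derivative that is
  normal to the surface and tangent to the hypersphere (whose normal at \<open>g p\<close> is \<open>g p - c\<close>).\<close>

definition second_fundamental_form ::
    "'b::euclidean_space \<Rightarrow> (complex \<Rightarrow> 'b) \<Rightarrow> complex \<Rightarrow> complex \<Rightarrow> complex \<Rightarrow> 'b" where
  "second_fundamental_form c g p h k =
     normal_part {pdx g p, pdy g p, g p - c}
       (frechet_derivative (\<lambda>q. frechet_derivative g (at q) k) (at p) h)"

text \<open>Half the trace of the second fundamental form with respect to the induced metric
  \<open>a dx\<^sup>2 + 2 b dx dy + d dy\<^sup>2\<close>.\<close>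

definition mean_curvature_vector ::
    "'b::euclidean_space \<Rightarrow> (complex \<Rightarrow> 'b) \<Rightarrow> complex \<Rightarrow> 'b" where
  "mean_curvature_vector c g p =
     (let a = pdx g p \<bullet> pdx g p; b = pdx g p \<bullet> pdy g p; d = pdy g p \<bullet> pdy g p;
          II = second_fundamental_form c g p
      in (1 / (2 * (a * d - b\<^sup>2))) *\<^sub>R (d *\<^sub>R II 1 1 - (2 * b) *\<^sub>R II 1 \<i> + a *\<^sub>R II \<i> \<i>))"

definition minimal_in_sphere ::
    "'a chart set \<Rightarrow> 'b::euclidean_space \<Rightarrow> real \<Rightarrow> ('a \<Rightarrow> 'b) \<Rightarrow> bool" where
  "minimal_in_sphere A c r f \<longleftrightarrow> immersion A f \<and> range f \<subseteq> sphere c r \<and>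
     everywhere_local A (\<lambda>g p. mean_curvature_vector c g p = 0) f"

definition totally_geodesic_in_sphere ::
    "'a chart set \<Rightarrow> 'b::euclidean_space \<Rightarrow> real \<Rightarrow> ('a \<Rightarrow> 'b) \<Rightarrow> bool" where
  "totally_geodesic_in_sphere A c r f \<longleftrightarrow> immersion A f \<and> range f \<subseteq> sphere c r \<and>
     everywhere_local A (\<lambda>g p. \<forall>h k. second_fundamental_form c g p h k = 0) f"


section \<open>Almost complex curves and the associated map\<close>

definition almost_complex_curve :: "'a chart set \<Rightarrow> ('a \<Rightarrow> real^7) \<Rightarrow> bool" where
  "almost_complex_curve A f \<longleftrightarrow> \<not> f constant_on UNIV \<and> smooth_map A f \<and> range f \<subseteq> sphere 0 1 \<and>
     everywhere_local A (\<lambda>g p. \<forall>h.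
       frechet_derivative g (at p) (\<i> * h) = cross7 (g p) (frechet_derivative g (at p) h)) f"

definition linearly_full_in :: "('a \<Rightarrow> 'b::real_vector) \<Rightarrow> 'b set \<Rightarrow> bool" where
  "linearly_full_in f U \<longleftrightarrow> range f \<subseteq> U \<and> \<not> (\<exists>W. subspace W \<and> range f \<subseteq> W \<and> W \<subset> U)"

definition type_III :: "'a chart set \<Rightarrow> ('a \<Rightarrow> real^7) \<Rightarrow> bool" where
  "type_III A f \<longleftrightarrow> almost_complex_curve A f \<and>
     (\<exists>U. subspace U \<and> dim U = 6 \<and> linearly_full_in f U)"

text \<open>\<open>dF = \<phi> \<times> *d\<phi>\<close>, that is, \<open>F\<^sub>x = \<phi> \<times> \<phi>\<^sub>y\<close> and \<open>F\<^sub>y = - \<phi> \<times> \<phi>\<^sub>x\<close>.\<close>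

definition is_cross_star_primitive :: "'a chart set \<Rightarrow> ('a \<Rightarrow> real^7) \<Rightarrow> ('a \<Rightarrow> real^7) \<Rightarrow> bool" where
  "is_cross_star_primitive A \<phi> F \<longleftrightarrow> (\<forall>(U, z)\<in>A. \<forall>p\<in>z ` U.
     let g = \<phi> \<circ> inv_into U z in
       ((F \<circ> inv_into U z) has_derivative
         (\<lambda>h. Re h *\<^sub>R cross7 (g p) (pdy g p) - Im h *\<^sub>R cross7 (g p) (pdx g p))) (at p))"

end

theory Submission
  imports Defs "HOL-Real_Asymp.Real_Asymp"
begin

text \<open>
  Let \<open>g\<close> be the expression of \<open>\<phi>\<close> in a conformal coordinate and \<open>l = \<bar>g\<^sub>x\<bar>\<^sup>2 = \<bar>g\<^sub>y\<bar>\<^sup>2\<close> the conformal factor.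
  Since \<open>g \<times> _\<close> is an isometry of the complement of \<open>g\<close>, the map \<open>F\<close> is conformal with the same factor,
  and its Laplacian is \<open>2 g\<^sub>x \<times> g\<^sub>y\<close>. A conformal map into a sphere with centre \<open>c\<close> is minimal there if and
  only if its Laplacian is parallel to \<open>F - c\<close>; comparing lengths, this forces the radius 1 and
  \<open>c - F = N\<close>, where \<open>N = g\<^sub>x \<times> g\<^sub>y / l\<close> is the Gauss map (\<open>minimal_F_imp\<close>). The theorem thus classifies
  the \<open>\<phi>\<close> for which \<open>N\<close> satisfies \<open>N\<^sub>x = - \<phi> \<times> \<phi>\<^sub>y\<close> and \<open>N\<^sub>y = \<phi> \<times> \<phi>\<^sub>x\<close>.

  If it does, then the derivatives of \<open>\<phi> \<bullet> N\<close> and of \<open>\<phi> \<times> N\<close> vanish (\<open>Gauss_map_derivatives\<close>), so that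
  both are constant on the connected surface. Let \<open>C = \<phi> \<bullet> N\<close>. If \<open>C = \<plusminus>1\<close>, then \<open>N = \<plusminus>\<phi>\<close> and the equation
  for \<open>N\<^sub>y\<close> says that \<open>\<phi>\<close> is almost complex for one of the two orientations. If \<open>\<bar>C\<bar> < 1\<close>, let \<open>v\<close> be the
  direction of the constant vector \<open>\<phi> \<times> N\<close>. It is orthogonal to \<open>\<phi>\<close>, and \<open>N\<close> is \<open>\<phi>\<close> rotated about \<open>v\<close> by
  the angle \<open>\<gamma>\<close> with cosine \<open>C\<close>. Hence \<open>\<phi> \<times> \<phi>\<^sub>x = R\<^sub>v(\<gamma>) \<phi>\<^sub>y\<close>. On the complement of \<open>v\<close> the product is,
  apart from its component along \<open>v\<close>, conjugate linear in both arguments with respect to \<open>v \<times> _\<close>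
  (\<open>cross7_rot7_rot7\<close>), and so the rotation of
  \<open>\<phi>\<close> by \<open>\<gamma> / 3\<close> is an almost complex curve (\<open>untwist_almost_complex\<close>). If this curve is not full in
  the complement of \<open>v\<close>, then a second constant vector is orthogonal to \<open>\<phi>\<close>, and the orthogonal frame made
  of \<open>\<phi>\<close>, \<open>\<phi>\<^sub>x\<close>, \<open>\<phi>\<^sub>y\<close>, their products with \<open>v\<close>, and \<open>v\<close> shows that the second fundamental form of \<open>\<phi>\<close>
  vanishes (\<open>horizontal_not_full_imp_totally_geodesic\<close>).

  Conversely, in the first two cases the same computation shows that \<open>F\<close> is, up to a translation, the
  image of \<open>\<phi>\<close> under a linear map that preserves lengths. Its Laplacian is then parallel to
  \<open>F - c\<close> because that of \<open>\<phi>\<close> is parallel to \<open>\<phi>\<close> (\<open>minimal_if_F_derivative\<close>). If \<open>\<phi>\<close> is totally geodesic,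
  then the two equations for \<open>N\<close> follow by differentiating its definition
  (\<open>totally_geodesic_imp_Gauss_map_derivative\<close>), and \<open>F + N\<close> is constant.

  Conditions with respect to the conjugate atlas are read in the charts of the given atlas, where they
  differ by a sign \<open>\<sigma>\<close>.
\<close>

section \<open>The cross product and the rotations of a hyperplane\<close>

lemma exhaust_7: fixes i :: 7 shows "i = 1 \<or> i = 2 \<or> i = 3 \<or> i = 4 \<or> i = 5 \<or> i = 6 \<or> i = 7"
proof (induct i)
  case (of_int z)
  then have "z = 0 \<or> z = 1 \<or> z = 2 \<or> z = 3 \<or> z = 4 \<or> z = 5 \<or> z = 6" by fastforce
  then show ?case by auto
qed

lemma forall_7: "(\<forall>i::7. P i) \<longleftrightarrow> P 1 \<and> P 2 \<and> P 3 \<and> P 4 \<and> P 5 \<and> P 6 \<and> P 7"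
  by (metis exhaust_7)

lemma UNIV_7: "UNIV = {1, 2, 3, 4, 5, 6, 7 :: 7}"
  using exhaust_7 by auto

lemma sum_7: "sum f (UNIV :: 7 set) = f 1 + f 2 + f 3 + f 4 + f 5 + f 6 + f 7"
  unfolding UNIV_7 by (simp add: ac_simps)

lemma axis_1_nth: "axis m (1::real) $ n = (if n = m then 1 else 0)"
  by (simp add: axis_def)

lemma cross7_nth:
  "cross7 x y $ 1 = x$2 * y$3 - x$3 * y$2 + (x$4 * y$5 - x$5 * y$4) + (x$7 * y$6 - x$6 * y$7)"
  "cross7 x y $ 2 = x$3 * y$1 - x$1 * y$3 + (x$4 * y$6 - x$6 * y$4) + (x$5 * y$7 - x$7 * y$5)"
  "cross7 x y $ 3 = x$1 * y$2 - x$2 * y$1 + (x$4 * y$7 - x$7 * y$4) + (x$6 * y$5 - x$5 * y$6)"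
  "cross7 x y $ 4 = x$5 * y$1 - x$1 * y$5 + (x$6 * y$2 - x$2 * y$6) + (x$7 * y$3 - x$3 * y$7)"
  "cross7 x y $ 5 = x$1 * y$4 - x$4 * y$1 + (x$7 * y$2 - x$2 * y$7) + (x$3 * y$6 - x$6 * y$3)"
  "cross7 x y $ 6 = x$1 * y$7 - x$7 * y$1 + (x$2 * y$4 - x$4 * y$2) + (x$5 * y$3 - x$3 * y$5)"
  "cross7 x y $ 7 = x$6 * y$1 - x$1 * y$6 + (x$2 * y$5 - x$5 * y$2) + (x$3 * y$4 - x$4 * y$3)"
  by (simp_all add: cross7_def cross7_triples_def axis_1_nth)

lemma bounded_bilinear_cross7: "bounded_bilinear cross7"
  using bilinear_conv_bounded_bilinear bilinear_cross7 by blast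

interpretation cross7: bounded_bilinear cross7
  by (rule bounded_bilinear_cross7)

lemma inner_cross7_assoc: "cross7 x y \<bullet> z = x \<bullet> cross7 y z"
  by (simp add: inner_vec_def sum_7 cross7_nth algebra_simps)

text \<open>This is alternativity of the octonion product. Together with \<open>inner_cross7_assoc\<close> it yields all
  further identities, by polarization and by taking inner products.\<close>

lemma cross7_cross7_same: "cross7 x (cross7 x y) = (x \<bullet> y) *\<^sub>R x - (x \<bullet> x) *\<^sub>R y"
  by (simp add: vec_eq_iff forall_7 inner_vec_def sum_7 cross7_nth algebra_simps)

lemma cross7_self [simp]: "cross7 x x = 0"
  using cross7_antisym[of x x] by (simp add: eq_neg_iff_add_eq_0 flip: scaleR_2)

lemma inner_cross7_self [simp]: "x \<bullet> cross7 x y = 0" "y \<bullet> cross7 x y = 0"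
  "cross7 x y \<bullet> x = 0" "cross7 x y \<bullet> y = 0"
proof -
  show *: "x \<bullet> cross7 x y = 0" for x y
    using inner_cross7_assoc[of x x y] by simp
  show **: "y \<bullet> cross7 x y = 0"
    using *[of y x] cross7_antisym[of y x] by simp
  show "cross7 x y \<bullet> x = 0" "cross7 x y \<bullet> y = 0"
    using * ** by (simp_all add: inner_commute)
qed

lemma inner_cross7_swap: "cross7 x y \<bullet> z = - (cross7 x z \<bullet> y)"
  by (metis cross7_antisym inner_cross7_assoc inner_commute inner_minus_left)

lemma cross7_cross7_polarized:
  "cross7 u (cross7 v w) + cross7 v (cross7 u w)
    = (u \<bullet> w) *\<^sub>R v + (v \<bullet> w) *\<^sub>R u - (2 * (u \<bullet> v)) *\<^sub>R w"
  using cross7_cross7_same[of "u + v" w] cross7_cross7_same[of u w] cross7_cross7_same[of v w]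
  by (simp add: cross7.add_left cross7.add_right algebra_simps inner_commute scaleR_2)

text \<open>In particular, for a unit vector \<open>v\<close> the complex structure \<open>v \<times> _\<close> on the complement of \<open>v\<close>
  anticommutes with \<open>u \<times> _\<close>, up to multiples of \<open>u\<close> and \<open>v\<close>.\<close>

lemma cross7_cross7_orthogonal:
  assumes "u \<bullet> v = 0" "u \<bullet> w = 0" "v \<bullet> w = 0"
  shows "cross7 u (cross7 v w) = - cross7 v (cross7 u w)"
  using cross7_cross7_polarized[of u v w] assms by (simp add: eq_neg_iff_add_eq_0)

lemma inner_cross7_cross7: "cross7 a b \<bullet> cross7 c b = (a \<bullet> c) * (b \<bullet> b) - (a \<bullet> b) * (b \<bullet> c)"
proof -
  have "cross7 a b \<bullet> cross7 c b = - (a \<bullet> cross7 b (cross7 b c))"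
    by (metis cross7_antisym inner_cross7_assoc inner_minus_right cross7.minus_right)
  then show ?thesis
    by (simp add: cross7_cross7_same inner_diff_right)
qed

lemma inner_cross7_cross7': "cross7 a b \<bullet> cross7 a c = (a \<bullet> a) * (b \<bullet> c) - (a \<bullet> b) * (a \<bullet> c)"
  using inner_cross7_cross7[of b a c] cross7_antisym[of a b] cross7_antisym[of a c]
  by (simp add: mult.commute inner_commute)

lemma cross7_cross7_same_left: "cross7 (cross7 x y) x = (x \<bullet> x) *\<^sub>R y - (x \<bullet> y) *\<^sub>R x"
  using cross7_cross7_same[of x y] cross7_antisym[of "cross7 x y" x] by simp

lemma rot7_orthogonal: "x \<bullet> v = 0 \<Longrightarrow> rot7 v \<beta> x = cos \<beta> *\<^sub>R x + sin \<beta> *\<^sub>R cross7 v x"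
  by (simp add: rot7_def)

lemma bounded_linear_rot7: "bounded_linear (rot7 v \<beta>)"
proof -
  have "linear (rot7 v \<beta>)"
    by (rule linearI)
      (simp_all add: rot7_def cross7.add_right cross7.scaleR_right algebra_simps)
  then show ?thesis
    by (simp add: linear_conv_bounded_linear)
qed

lemma rot7_inner_axis: "norm v = 1 \<Longrightarrow> rot7 v \<beta> x \<bullet> v = x \<bullet> v"
  by (simp add: rot7_def inner_add_left inner_diff_left norm_eq_1)

lemma inner_rot7_rot7:
  assumes "norm v = 1"
  shows "rot7 v \<beta> x \<bullet> rot7 v \<beta> y = x \<bullet> y"
proof -
  have v: "v \<bullet> v = 1"
    using assms by (simp add: norm_eq_1)
  define x' y' where "x' = x - (x \<bullet> v) *\<^sub>R v" and "y' = y - (y \<bullet> v) *\<^sub>R v"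
  have x': "v \<bullet> x' = 0" "v \<bullet> y' = 0" "x' \<bullet> v = 0"
    by (simp_all add: x'_def y'_def inner_diff_right inner_diff_left v inner_commute)
  have c: "cross7 v x = cross7 v x'" "cross7 v y = cross7 v y'"
    by (simp_all add: x'_def y'_def cross7.diff_right cross7.scaleR_right)
  have sym: "x' \<bullet> cross7 v y' + cross7 v x' \<bullet> y' = 0"
    using inner_cross7_swap[of v x' y'] by (simp add: inner_commute)
  have "rot7 v \<beta> x \<bullet> rot7 v \<beta> y = (x \<bullet> v) * (y \<bullet> v)
      + ((cos \<beta>)\<^sup>2 + (sin \<beta>)\<^sup>2) * (x' \<bullet> y')
      + cos \<beta> * sin \<beta> * (x' \<bullet> cross7 v y' + cross7 v x' \<bullet> y')"
    unfolding rot7_def x'_def[symmetric] y'_def[symmetric] c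
    by (simp only: power2_eq_square)
      (simp add: inner_add_left inner_add_right x' v inner_cross7_cross7' algebra_simps
        del: sin_cos_squared_add3)
  also have "\<dots> = (x \<bullet> v) * (y \<bullet> v) + x' \<bullet> y'"
    by (simp add: sym)
  also have "\<dots> = x \<bullet> y"
    by (simp add: x'_def y'_def inner_diff_left inner_diff_right v inner_commute)
  finally show ?thesis .
qed

text \<open>On the complement of \<open>v\<close> the map \<open>v \<times> _\<close> squares to \<open>-1\<close>, so that \<open>rot7 v\<close> is there the
  multiplication by \<open>exp (\<i> \<beta>)\<close>.\<close>

lemma rot7_rot7:
  assumes "norm v = 1" "x \<bullet> v = 0"
  shows "rot7 v \<alpha> (rot7 v \<beta> x) = rot7 v (\<alpha> + \<beta>) x"
proof -
  have "v \<bullet> v = 1" "v \<bullet> x = 0"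
    using assms by (simp_all add: norm_eq_1 inner_commute)
  then show ?thesis
    using assms rot7_inner_axis[OF assms(1), of \<beta> x]
    by (simp add: rot7_orthogonal cross7.add_right cross7.scaleR_right cross7_cross7_same
        cos_add sin_add algebra_simps)
qed

lemma rot7_0: "rot7 v 0 x = x"
  by (simp add: rot7_def)

text \<open>Apart from its component along \<open>v\<close>, the product of two vectors orthogonal to \<open>v\<close> is conjugate
  linear in both of them for the complex structure \<open>v \<times> _\<close>. Rotating both factors by \<open>\<alpha>\<close> hence
  rotates the product by \<open>-2\<alpha>\<close>.\<close>

lemma cross7_rot7_rot7:
  assumes v: "norm v = 1" "u \<bullet> v = 0" "w \<bullet> v = 0" and uw: "u \<bullet> w = 0" "cross7 u w \<bullet> v = 0"
  shows "cross7 (rot7 v \<alpha> u) (rot7 v \<alpha> w) = rot7 v (- 2 * \<alpha>) (cross7 u w)"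
proof -
  let ?m = "cross7 u w"
  have vv: "v \<bullet> v = 1"
    using v by (simp add: norm_eq_1)
  have vu: "v \<bullet> u = 0" "v \<bullet> w = 0" "v \<bullet> ?m = 0" "w \<bullet> u = 0"
    using assms by (simp_all add: inner_commute)
  have 1: "cross7 u (cross7 v w) = - cross7 v ?m"
    using assms vu by (intro cross7_cross7_orthogonal) auto
  have "cross7 w (cross7 v u) = - cross7 v (cross7 w u)"
    using assms vu by (intro cross7_cross7_orthogonal) auto
  then have 2: "cross7 (cross7 v u) w = - cross7 v ?m"
    using cross7_antisym[of "cross7 v u" w] cross7_antisym[of w u] by (simp add: cross7.minus_right)
  have "cross7 v u \<bullet> w = 0"
    using inner_cross7_assoc[of v u w] vu by simp
  then have "cross7 (cross7 v u) (cross7 v w) = - cross7 v (cross7 (cross7 v u) w)"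
    using assms vu by (intro cross7_cross7_orthogonal) auto
  also have "\<dots> = - ?m"
    unfolding 2 by (simp add: cross7.minus_right cross7_cross7_same vv vu)
  finally have 3: "cross7 (cross7 v u) (cross7 v w) = - ?m" .
  have "cross7 (rot7 v \<alpha> u) (rot7 v \<alpha> w)
      = (cos \<alpha> * cos \<alpha> - sin \<alpha> * sin \<alpha>) *\<^sub>R ?m - (2 * (sin \<alpha> * cos \<alpha>)) *\<^sub>R cross7 v ?m"
    unfolding rot7_orthogonal[OF v(2)] rot7_orthogonal[OF v(3)]
    by (simp add: cross7.add_left cross7.add_right cross7.scaleR_left cross7.scaleR_right 1 2 3
        algebra_simps flip: scaleR_2)
  also have "\<dots> = rot7 v (- 2 * \<alpha>) ?m"
    using uw(2) by (simp add: rot7_orthogonal cos_double sin_double power2_eq_square)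
  finally show ?thesis .
qed

section \<open>Calculus of smooth functions\<close>

lemma frechet_derivative_cong_open:
  assumes "open S" "p \<in> S" "\<And>q. q \<in> S \<Longrightarrow> f q = k q"
  shows "frechet_derivative f (at p) = frechet_derivative k (at p)"
proof -
  have "(f has_derivative D) (at p) \<longleftrightarrow> (k has_derivative D) (at p)" for D
    using has_derivative_transform_within_open[of f D p UNIV S k]
      has_derivative_transform_within_open[of k D p UNIV S f] assms by auto
  then show ?thesis
    by (simp add: frechet_derivative_def)
qed

lemma frechet_derivative_eq_0_open:
  assumes "open S" "p \<in> S" "\<And>q. q \<in> S \<Longrightarrow> f q = c"
  shows "frechet_derivative f (at p) h = 0"
  using frechet_derivative_cong_open[OF assms] by simp

lemma differentiable_cong_open:
  assumes "open S" "p \<in> S" "\<And>q. q \<in> S \<Longrightarrow> f q = k q" "f differentiable at p"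
  shows "k differentiable at p"
proof -
  from assms(4) obtain D where "(f has_derivative D) (at p)"
    by (auto simp: differentiable_def)
  from has_derivative_transform_within_open[OF this assms(1,2)] assms(3) show ?thesis
    by (auto simp: differentiable_def)
qed

lemma has_derivative_frechet:
  "f differentiable at p \<Longrightarrow> (f has_derivative frechet_derivative f (at p)) (at p)"
  by (rule iffD1[OF frechet_derivative_works])

lemma has_derivative_frechet_bilinear:
  fixes B :: "'b::real_normed_vector \<Rightarrow> 'c::real_normed_vector \<Rightarrow> 'd::real_normed_vector"
    and f :: "'e::real_normed_vector \<Rightarrow> 'b" and k :: "'e \<Rightarrow> 'c"
  assumes "bounded_bilinear B" "f differentiable at p" "k differentiable at p"
  shows "((\<lambda>q. B (f q) (k q)) has_derivative (\<lambda>h.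
    B (f p) (frechet_derivative k (at p) h) + B (frechet_derivative f (at p) h) (k p))) (at p)"
  by (rule bounded_bilinear.FDERIV[OF assms(1) has_derivative_frechet[OF assms(2)] has_derivative_frechet[OF assms(3)]])

lemma has_derivative_imp_frechet:
  assumes "(f has_derivative D) (at p)"
  shows "frechet_derivative f (at p) h = D h" and "f differentiable at p"
  using frechet_derivative_at[OF assms] assms by (simp_all add: differentiableI)

lemma frechet_derivative_bilinear:
  fixes B :: "'b::real_normed_vector \<Rightarrow> 'c::real_normed_vector \<Rightarrow> 'd::real_normed_vector"
    and f :: "'e::real_normed_vector \<Rightarrow> 'b" and k :: "'e \<Rightarrow> 'c"
  assumes "bounded_bilinear B" "f differentiable at p" "k differentiable at p"
  shows "frechet_derivative (\<lambda>q. B (f q) (k q)) (at p) h =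
      B (f p) (frechet_derivative k (at p) h) + B (frechet_derivative f (at p) h) (k p)"
    and "(\<lambda>q. B (f q) (k q)) differentiable at p"
  by (rule has_derivative_imp_frechet[OF has_derivative_frechet_bilinear[OF assms]])+

lemma frechet_derivative_inner:
  fixes f k :: "'b::real_normed_vector \<Rightarrow> 'c::real_inner"
  assumes "f differentiable at p" "k differentiable at p"
  shows "frechet_derivative (\<lambda>q. f q \<bullet> k q) (at p) h =
      f p \<bullet> frechet_derivative k (at p) h + frechet_derivative f (at p) h \<bullet> k p"
    and "(\<lambda>q. f q \<bullet> k q) differentiable at p"
  using frechet_derivative_bilinear[OF bounded_bilinear_inner assms] by auto

lemma frechet_derivative_cross7:
  assumes "f differentiable at p" "k differentiable at p"
  shows "frechet_derivative (\<lambda>q. cross7 (f q) (k q)) (at p) h =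
      cross7 (f p) (frechet_derivative k (at p) h) + cross7 (frechet_derivative f (at p) h) (k p)"
    and "(\<lambda>q. cross7 (f q) (k q)) differentiable at p"
  using frechet_derivative_bilinear[OF bounded_bilinear_cross7 assms] by auto

lemma frechet_derivative_bounded_linear:
  assumes "bounded_linear L" "f differentiable at p"
  shows "frechet_derivative (\<lambda>q. L (f q)) (at p) h = L (frechet_derivative f (at p) h)"
    and "(\<lambda>q. L (f q)) differentiable at p"
proof -
  have "((\<lambda>q. L (f q)) has_derivative (\<lambda>h. L (frechet_derivative f (at p) h))) (at p)"
    by (rule bounded_linear.has_derivative[OF assms(1) has_derivative_frechet[OF assms(2)]])
  from has_derivative_imp_frechet[OF this]
  show "frechet_derivative (\<lambda>q. L (f q)) (at p) h = L (frechet_derivative f (at p) h)"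
    and "(\<lambda>q. L (f q)) differentiable at p"
    by auto
qed

lemma frechet_derivative_add:
  assumes "f differentiable at p" "k differentiable at p"
  shows "frechet_derivative (\<lambda>q. f q + k q) (at p) h =
    frechet_derivative f (at p) h + frechet_derivative k (at p) h"
proof (rule has_derivative_imp_frechet(1))
  show "((\<lambda>q. f q + k q) has_derivative (\<lambda>h. frechet_derivative f (at p) h + frechet_derivative k (at p) h)) (at p)"
    by (intro has_derivative_add has_derivative_frechet assms)
qed

lemma frechet_derivative_complex:
  assumes "f differentiable at (p :: complex)"
  shows "frechet_derivative f (at p) h = Re h *\<^sub>R pdx f p + Im h *\<^sub>R pdy f p"
proof -
  interpret linear "frechet_derivative f (at p)"
    using assms by (rule linear_frechet_derivative)
  have "h = Re h *\<^sub>R 1 + Im h *\<^sub>R \<i>"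
    by (simp add: complex_eq_iff)
  then show ?thesis
    by (metis add scale)
qed

lemma frechet_derivative_compose_cnj:
  assumes "f differentiable at (cnj p)"
  shows "frechet_derivative (f \<circ> cnj) (at p) h = frechet_derivative f (at (cnj p)) (cnj h)"
    and "(f \<circ> cnj) differentiable at p"
proof -
  have "(cnj has_derivative cnj) (at p)"
    by (simp add: bounded_linear_cnj bounded_linear_imp_has_derivative)
  then have "(f \<circ> cnj has_derivative (frechet_derivative f (at (cnj p)) \<circ> cnj)) (at p)"
    by (rule diff_chain_at) (rule has_derivative_frechet[OF assms])
  from has_derivative_imp_frechet[OF this]
  show "frechet_derivative (f \<circ> cnj) (at p) h = frechet_derivative f (at (cnj p)) (cnj h)"
    and "(f \<circ> cnj) differentiable at p"
    by auto
qed

lemma Ck_on_cong: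
  assumes "open S"
  shows "(\<And>x. x \<in> S \<Longrightarrow> f x = g x) \<Longrightarrow> Ck_on n f S \<Longrightarrow> Ck_on n g S"
proof (induction n arbitrary: f g)
  case 0
  then show ?case by (metis Ck_on.simps(1) continuous_on_cong)
next
  case (Suc n)
  have "g differentiable at x" if "x \<in> S" for x
  proof (rule differentiable_cong_open[OF assms that])
    show "f q = g q" if "q \<in> S" for q
      using Suc.prems(1) that .
    show "f differentiable at x"
      using Suc.prems(2) that by simp
  qed
  moreover have "Ck_on n (\<lambda>x. frechet_derivative g (at x) h) S" for h
  proof (rule Suc.IH)
    show "Ck_on n (\<lambda>x. frechet_derivative f (at x) h) S"
      using Suc.prems(2) by simp
    show "frechet_derivative f (at x) h = frechet_derivative g (at x) h" if "x \<in> S" for x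
      using frechet_derivative_cong_open[OF assms that Suc.prems(1)] by simp
  qed
  ultimately show ?case by simp
qed

lemma Ck_on_SucD: "Ck_on (Suc n) f S \<Longrightarrow> Ck_on n f S"
proof (induction n arbitrary: f)
  case 0
  then show ?case
    by (auto intro!: continuous_at_imp_continuous_on differentiable_imp_continuous_within)
next
  case (Suc n)
  then show ?case by (metis Ck_on.simps(2))
qed

lemma Ck_on_bounded_linear:
  assumes "open S" "bounded_linear L"
  shows "Ck_on n f S \<Longrightarrow> Ck_on n (\<lambda>x. L (f x)) S"
proof (induction n arbitrary: f)
  case 0
  then show ?case
    using assms by (simp add: bounded_linear.continuous_on)
next
  case (Suc n)
  have "Ck_on n (\<lambda>x. frechet_derivative (\<lambda>x. L (f x)) (at x) h) S" for h
  proof (rule Ck_on_cong[OF assms(1)])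
    show "Ck_on n (\<lambda>x. L (frechet_derivative f (at x) h)) S"
      using Suc by simp
  qed (use Suc.prems in \<open>simp add: frechet_derivative_bounded_linear(1)[OF assms(2)]\<close>)
  then show ?case
    using Suc.prems by (simp add: frechet_derivative_bounded_linear(2)[OF assms(2)])
qed

lemma Ck_on_add:
  assumes "open S"
  shows "Ck_on n f S \<Longrightarrow> Ck_on n g S \<Longrightarrow> Ck_on n (\<lambda>x. f x + g x) S"
proof (induction n arbitrary: f g)
  case 0
  then show ?case by (simp add: continuous_on_add)
next
  case (Suc n)
  have "Ck_on n (\<lambda>x. frechet_derivative (\<lambda>x. f x + g x) (at x) h) S" for h
  proof (rule Ck_on_cong[OF assms])
    show "Ck_on n (\<lambda>x. frechet_derivative f (at x) h + frechet_derivative g (at x) h) S"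
      using Suc by simp
  qed (use Suc.prems in \<open>simp add: frechet_derivative_add\<close>)
  then show ?case
    using Suc.prems by simp
qed

text \<open>The product rule expresses a derivative of the product through products of functions of class
  \<open>C\<^sup>n\<close>; the factor that is not differentiated has one derivative to spare.\<close>

lemma Ck_on_bilinear:
  assumes "open S" "bounded_bilinear B"
  shows "Ck_on n f S \<Longrightarrow> Ck_on n g S \<Longrightarrow> Ck_on n (\<lambda>x. B (f x) (g x)) S"
proof (induction n arbitrary: f g)
  case 0
  then show ?case
    using assms bounded_bilinear.continuous_on by fastforce
next
  case (Suc n)
  have "Ck_on n (\<lambda>x. frechet_derivative (\<lambda>x. B (f x) (g x)) (at x) h) S" for h
  proof (rule Ck_on_cong[OF assms(1)])
    show "Ck_on n (\<lambda>x. B (f x) (frechet_derivative g (at x) h)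
        + B (frechet_derivative f (at x) h) (g x)) S"
      using Suc.prems Ck_on_SucD[OF Suc.prems(1)] Ck_on_SucD[OF Suc.prems(2)]
      by (intro Ck_on_add[OF assms(1)] Suc.IH) simp_all
  qed (use Suc.prems in \<open>auto simp: frechet_derivative_bilinear(1)[OF assms(2)]\<close>)
  then show ?case
    using Suc.prems by (simp add: frechet_derivative_bilinear(2)[OF assms(2)])
qed

lemma open_cnj_image:
  assumes "open S"
  shows "open (cnj ` S)"
proof -
  have "cnj ` S = cnj -` S"
    by (auto intro: image_eqI[of _ cnj "cnj x" for x])
  then show ?thesis
    using assms by (simp add: open_vimage continuous_on_cnj)
qed

lemma Ck_on_compose_cnj:
  assumes "open S"
  shows "Ck_on n f S \<Longrightarrow> Ck_on n (f \<circ> cnj) (cnj ` S)"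
proof (induction n arbitrary: f)
  case 0
  then show ?case
    by (auto intro!: continuous_on_compose2[of S f "cnj ` S" cnj] continuous_intros simp: o_def)
next
  case (Suc n)
  have o: "open (cnj ` S)"
    using assms by (simp add: open_cnj_image)
  have "Ck_on n (\<lambda>x. frechet_derivative (f \<circ> cnj) (at x) h) (cnj ` S)" for h
  proof (rule Ck_on_cong[OF o])
    show "Ck_on n ((\<lambda>x. frechet_derivative f (at x) (cnj h)) \<circ> cnj) (cnj ` S)"
      using Suc.prems by (intro Suc.IH) simp
  qed (use Suc.prems in \<open>auto simp: frechet_derivative_compose_cnj(1)\<close>)
  moreover have "(f \<circ> cnj) differentiable at y" if "y \<in> cnj ` S" for y
    using that Suc.prems by (intro frechet_derivative_compose_cnj(2)) auto
  ultimately show ?case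
    unfolding Ck_on.simps by blast
qed

lemma smooth_on_cong: "open S \<Longrightarrow> (\<And>x. x \<in> S \<Longrightarrow> f x = g x) \<Longrightarrow> smooth_on f S \<Longrightarrow> smooth_on g S"
  unfolding smooth_on_def by (meson Ck_on_cong)

lemma smooth_on_differentiable: "smooth_on f S \<Longrightarrow> p \<in> S \<Longrightarrow> f differentiable at p"
  unfolding smooth_on_def using Ck_on.simps(2) by blast

lemma smooth_on_frechet_derivative:
  "smooth_on f S \<Longrightarrow> smooth_on (\<lambda>x. frechet_derivative f (at x) h) S"
  unfolding smooth_on_def using Ck_on.simps(2) by blast

lemma smooth_on_continuous: "smooth_on f S \<Longrightarrow> continuous_on S f"
  unfolding smooth_on_def using Ck_on.simps(1) by blast

lemma smooth_onI:
  assumes "\<And>x. x \<in> S \<Longrightarrow> f differentiable at x"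
    and "\<And>h. smooth_on (\<lambda>x. frechet_derivative f (at x) h) S"
  shows "smooth_on f S"
proof -
  have "Ck_on (Suc n) f S" for n
    using assms by (simp add: smooth_on_def)
  then show ?thesis
    unfolding smooth_on_def by (blast intro: Ck_on_SucD)
qed

lemma smooth_on_bounded_linear:
  "open S \<Longrightarrow> bounded_linear L \<Longrightarrow> smooth_on f S \<Longrightarrow> smooth_on (\<lambda>x. L (f x)) S"
  unfolding smooth_on_def by (simp add: Ck_on_bounded_linear)

lemma smooth_on_add:
  "open S \<Longrightarrow> smooth_on f S \<Longrightarrow> smooth_on g S \<Longrightarrow> smooth_on (\<lambda>x. f x + g x) S"
  unfolding smooth_on_def by (simp add: Ck_on_add)

lemma smooth_on_cross7:
  "open S \<Longrightarrow> smooth_on f S \<Longrightarrow> smooth_on g S \<Longrightarrow> smooth_on (\<lambda>x. cross7 (f x) (g x)) S"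
  unfolding smooth_on_def by (simp add: Ck_on_bilinear[OF _ bounded_bilinear_cross7])

lemma mvt_line:
  fixes u :: "complex \<Rightarrow> real"
  assumes "t > 0" "\<And>s. 0 \<le> s \<Longrightarrow> s \<le> t \<Longrightarrow> u differentiable at (q + s *\<^sub>R d)"
  obtains s where "0 < s" "s < t"
    "u (q + t *\<^sub>R d) - u q = t * frechet_derivative u (at (q + s *\<^sub>R d)) d"
proof -
  have "((\<lambda>s. u (q + s *\<^sub>R d)) has_real_derivative frechet_derivative u (at (q + s *\<^sub>R d)) d) (at s)"
    if s: "0 \<le> s" "s \<le> t" for s
  proof -
    have 1: "((\<lambda>s. q + s *\<^sub>R d) has_derivative (\<lambda>h. h *\<^sub>R d)) (at s)"
      by (auto intro!: derivative_eq_intros)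
    interpret D: linear "frechet_derivative u (at (q + s *\<^sub>R d))"
      using assms s by (simp add: linear_frechet_derivative)
    show ?thesis
      using diff_chain_at[OF 1 has_derivative_frechet[OF assms(2)[OF s]]]
      by (simp add: has_field_derivative_def o_def D.scale mult_commute_abs)
  qed
  from MVT2[OF assms(1) this] that show ?thesis
    by (auto simp: algebra_simps)
qed

text \<open>The mean value theorem in the direction \<open>d\<close> for the difference of \<open>u\<close> in the direction \<open>e\<close>, and
  then in the direction \<open>e\<close>. The left-hand side is symmetric in \<open>d\<close> and \<open>e\<close>; this is what makes
  the mixed partial derivatives agree.\<close>

lemma second_difference_mvt:
  fixes u :: "complex \<Rightarrow> real"
  assumes "smooth_on u S" "t > 0" "\<And>a b. 0 \<le> a \<Longrightarrow> a \<le> t \<Longrightarrow> 0 \<le> b \<Longrightarrow> b \<le> t \<Longrightarrow> p + a *\<^sub>R d + b *\<^sub>R e \<in> S"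
  obtains a b where "0 < a" "a < t" "0 < b" "b < t"
    "u (p + t *\<^sub>R d + t *\<^sub>R e) - u (p + t *\<^sub>R d) - u (p + t *\<^sub>R e) + u p =
      t * t * frechet_derivative (\<lambda>q. frechet_derivative u (at q) d) (at (p + a *\<^sub>R d + b *\<^sub>R e)) e"
proof -
  define k where "k q = u (q + t *\<^sub>R e) - u q" for q
  have D: "u differentiable at (p + a *\<^sub>R d + b *\<^sub>R e)" if "0 \<le> a" "a \<le> t" "0 \<le> b" "b \<le> t" for a b
    using smooth_on_differentiable[OF assms(1) assms(3)] that by blast
  have k: "k differentiable at (p + s *\<^sub>R d)"
      "frechet_derivative k (at (p + s *\<^sub>R d)) d =
       frechet_derivative u (at (p + s *\<^sub>R d + t *\<^sub>R e)) d - frechet_derivative u (at (p + s *\<^sub>R d)) d"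
    if "0 \<le> s" "s \<le> t" for s
  proof -
    have 1: "(u has_derivative frechet_derivative u (at (p + s *\<^sub>R d))) (at (p + s *\<^sub>R d))"
      using D[of s 0] that assms(2) by (intro has_derivative_frechet) simp
    have 2: "((\<lambda>q. q + t *\<^sub>R e) has_derivative (\<lambda>h. h)) (at (p + s *\<^sub>R d))"
      by (auto intro!: derivative_eq_intros)
    have 3: "(u has_derivative frechet_derivative u (at (p + s *\<^sub>R d + t *\<^sub>R e))) (at (p + s *\<^sub>R d + t *\<^sub>R e))"
      using D[of s t] that assms(2) by (intro has_derivative_frechet) simp
    have "(k has_derivative (\<lambda>h. frechet_derivative u (at (p + s *\<^sub>R d + t *\<^sub>R e)) h
        - frechet_derivative u (at (p + s *\<^sub>R d)) h)) (at (p + s *\<^sub>R d))"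
      using has_derivative_diff[OF diff_chain_at[OF 2 3] 1] by (simp add: k_def[abs_def] o_def)
    from has_derivative_imp_frechet[OF this]
    show "k differentiable at (p + s *\<^sub>R d)"
      "frechet_derivative k (at (p + s *\<^sub>R d)) d =
       frechet_derivative u (at (p + s *\<^sub>R d + t *\<^sub>R e)) d - frechet_derivative u (at (p + s *\<^sub>R d)) d"
      by auto
  qed
  obtain a where a: "0 < a" "a < t" "k (p + t *\<^sub>R d) - k p = t * frechet_derivative k (at (p + a *\<^sub>R d)) d"
    using mvt_line[OF assms(2), of k p d] k(1) by blast
  define w where "w q = frechet_derivative u (at q) d" for q
  have w: "smooth_on w S"
    unfolding w_def using assms(1) by (rule smooth_on_frechet_derivative)
  obtain b where b: "0 < b" "b < t"
    "w (p + a *\<^sub>R d + t *\<^sub>R e) - w (p + a *\<^sub>R d) = t * frechet_derivative w (at (p + a *\<^sub>R d + b *\<^sub>R e)) e"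
    using mvt_line[OF assms(2), of w "p + a *\<^sub>R d" e] smooth_on_differentiable[OF w assms(3)] a by auto
  have "k (p + t *\<^sub>R d) - k p = t * (w (p + a *\<^sub>R d + t *\<^sub>R e) - w (p + a *\<^sub>R d))"
    using a k(2)[of a] by (simp add: w_def)
  then have "k (p + t *\<^sub>R d) - k p = t * t * frechet_derivative w (at (p + a *\<^sub>R d + b *\<^sub>R e)) e"
    by (simp add: b(3))
  moreover have "k (p + t *\<^sub>R d) - k p =
      u (p + t *\<^sub>R d + t *\<^sub>R e) - u (p + t *\<^sub>R d) - u (p + t *\<^sub>R e) + u p"
    by (simp add: k_def)
  moreover have "w = (\<lambda>q. frechet_derivative u (at q) d)"
    by (rule ext) (rule w_def)
  ultimately show ?thesis
    using that[OF a(1,2) b(1,2)] by simp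
qed

text \<open>Both mixed partials are attained, at points within \<open>2t\<close> of \<open>p\<close>, by the same second difference
  quotient of step \<open>t\<close>; let \<open>t\<close> tend to 0.\<close>

lemma second_partials_commute_real:
  fixes u :: "complex \<Rightarrow> real"
  assumes "open S" "smooth_on u S" "p \<in> S"
  shows "pdx (pdy u) p = pdy (pdx u) p"
proof -
  obtain r where r: "r > 0" "ball p r \<subseteq> S"
    using assms openE by blast
  \<comment> \<open>Steps so small that the squares used by the second differences stay in the ball.\<close>
  define t where "t n = r / (2 * (real n + 2))" for n
  have t: "t n > 0" "2 * t n < r" for n
  proof -
    show "t n > 0"
      using r by (simp add: t_def)
    have "r * 1 < r * (real n + 2)"
      using r by (intro mult_strict_left_mono) auto
    then show "2 * t n < r"
      by (simp add: t_def divide_simps distrib_left)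
  qed
  have near: "dist (p + a *\<^sub>R d + b *\<^sub>R e) p \<le> 2 * t n"
    if "0 \<le> a" "a \<le> t n" "0 \<le> b" "b \<le> t n" "norm d = 1" "norm e = 1" for a b d e n
    using norm_triangle_ineq[of "a *\<^sub>R d" "b *\<^sub>R e"] that
    by (simp add: dist_norm algebra_simps)
  have inS: "p + a *\<^sub>R d + b *\<^sub>R e \<in> S"
    if "0 \<le> a" "a \<le> t n" "0 \<le> b" "b \<le> t n" "norm d = 1" "norm e = 1" for a b d e n
    using near[OF that] t[of n] r by (auto simp: dist_commute subset_iff)
  have lim: "x \<longlonglongrightarrow> p" if "\<And>n. dist (x n) p \<le> 2 * t n" for x
  proof (rule metric_tendsto_imp_tendsto)
    show "(\<lambda>n. 2 * t n) \<longlonglongrightarrow> 0"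
      unfolding t_def by real_asymp
    show "eventually (\<lambda>n. dist (x n) p \<le> dist (2 * t n) 0) sequentially"
      using that t by (auto simp: less_imp_le abs_of_pos)
  qed
  have "\<exists>x y. dist x p \<le> 2 * t n \<and> dist y p \<le> 2 * t n \<and> pdy (pdx u) x = pdx (pdy u) y" for n
  proof -
    obtain a b where ab: "0 < a" "a < t n" "0 < b" "b < t n"
      "u (p + t n *\<^sub>R 1 + t n *\<^sub>R \<i>) - u (p + t n *\<^sub>R 1) - u (p + t n *\<^sub>R \<i>) + u p =
        t n * t n * pdy (pdx u) (p + a *\<^sub>R 1 + b *\<^sub>R \<i>)"
      using second_difference_mvt[OF assms(2) t(1)[of n] inS[of _ n _ 1 \<i>]] by auto
    obtain c d where cd: "0 < c" "c < t n" "0 < d" "d < t n"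
      "u (p + t n *\<^sub>R \<i> + t n *\<^sub>R 1) - u (p + t n *\<^sub>R \<i>) - u (p + t n *\<^sub>R 1) + u p =
        t n * t n * pdx (pdy u) (p + c *\<^sub>R \<i> + d *\<^sub>R 1)"
      using second_difference_mvt[OF assms(2) t(1)[of n] inS[of _ n _ \<i> 1]] by auto
    have "t n * t n * pdy (pdx u) (p + a *\<^sub>R 1 + b *\<^sub>R \<i>) = t n * t n * pdx (pdy u) (p + c *\<^sub>R \<i> + d *\<^sub>R 1)"
      unfolding ab(5)[symmetric] cd(5)[symmetric] by (simp add: algebra_simps)
    then show ?thesis
      using near[of a n b 1 \<i>] near[of c n d \<i> 1] ab(1-4) cd(1-4) t(1)[of n]
      by (intro exI conjI) auto
  qed
  then obtain x y where xy: "\<And>n. dist (x n) p \<le> 2 * t n" "\<And>n. dist (y n) p \<le> 2 * t n"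
      "\<And>n. pdy (pdx u) (x n) = pdx (pdy u) (y n)"
    by metis
  have cont: "isCont (\<lambda>q. frechet_derivative (\<lambda>q. frechet_derivative u (at q) d) (at q) e) p" for d e
    using smooth_on_continuous[OF smooth_on_frechet_derivative[OF smooth_on_frechet_derivative[OF assms(2)]]]
      assms(1,3) by (simp add: continuous_on_eq_continuous_at)
  have "(\<lambda>n. pdy (pdx u) (x n)) \<longlonglongrightarrow> pdy (pdx u) p"
    using isCont_tendsto_compose[OF cont lim[OF xy(1)]] .
  moreover have "(\<lambda>n. pdy (pdx u) (x n)) \<longlonglongrightarrow> pdx (pdy u) p"
    unfolding xy(3) using isCont_tendsto_compose[OF cont lim[OF xy(2)]] .
  ultimately show ?thesis
    using LIMSEQ_unique by blast
qed

lemma second_partials_commute: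
  fixes g :: "complex \<Rightarrow> 'b::real_inner"
  assumes "open S" "smooth_on g S" "p \<in> S"
  shows "pdx (pdy g) p = pdy (pdx g) p"
proof -
  have "pdx (pdy g) p \<bullet> w = pdy (pdx g) p \<bullet> w" for w
  proof -
    note L = bounded_linear_inner_left[of w]
    have D1: "frechet_derivative (\<lambda>q. g q \<bullet> w) (at q) h = frechet_derivative g (at q) h \<bullet> w"
      if "q \<in> S" for q h
      using frechet_derivative_bounded_linear[OF L smooth_on_differentiable[OF assms(2) that]] by simp
    have D2: "frechet_derivative (\<lambda>q. frechet_derivative (\<lambda>q. g q \<bullet> w) (at q) h) (at p) k
        = frechet_derivative (\<lambda>q. frechet_derivative g (at q) h) (at p) k \<bullet> w" for h k
      using frechet_derivative_cong_open[OF assms(1,3) D1]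
        frechet_derivative_bounded_linear[OF L smooth_on_differentiable[OF smooth_on_frechet_derivative[OF assms(2)] assms(3)]]
      by simp
    show ?thesis
      using second_partials_commute_real[OF assms(1) smooth_on_bounded_linear[OF assms(1) L assms(2)] assms(3)]
      by (simp add: D2)
  qed
  then show ?thesis
    using vector_eq_ldot by (metis inner_commute)
qed

section \<open>The normal part of a vector\<close>

text \<open>The decomposition into a normal and a tangential part is unique, since the difference of two
  candidates is both orthogonal to the span and contained in it.\<close>

lemma normal_part_eqI:
  assumes "\<And>b. b \<in> B \<Longrightarrow> n \<bullet> b = 0" "v - n \<in> span B"
  shows "normal_part B v = n"
  unfolding normal_part_def
proof (rule the_equality)
  fix m assume m: "(\<forall>b\<in>B. m \<bullet> b = 0) \<and> v - m \<in> span B"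
  have "m - n \<in> span B"
    using span_diff[OF assms(2) conjunct2[OF m]] by simp
  moreover have "orthogonal (m - n) b" if "b \<in> B" for b
    using that assms(1) m by (simp add: orthogonal_def inner_diff_left)
  ultimately have "orthogonal (m - n) (m - n)"
    by (rule orthogonal_to_span)
  then show "m = n"
    by (simp add: orthogonal_def)
qed (use assms in blast)

lemma normal_part_spec:
  shows "b \<in> B \<Longrightarrow> normal_part B v \<bullet> b = 0" and "v - normal_part B v \<in> span B"
proof -
  obtain y z where yz: "y \<in> span B" "\<And>w. w \<in> span B \<Longrightarrow> orthogonal z w" "v = y + z"
    using orthogonal_subspace_decomp_exists[of B v] by metis
  have "normal_part B v = z"
    using yz by (intro normal_part_eqI) (auto simp: orthogonal_def span_base)
  then show "b \<in> B \<Longrightarrow> normal_part B v \<bullet> b = 0" and "v - normal_part B v \<in> span B"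
    using yz by (auto simp: orthogonal_def span_base)
qed

lemma normal_part_eq_0_iff: "normal_part B v = 0 \<longleftrightarrow> v \<in> span B"
  using normal_part_spec(2)[of v B] normal_part_eqI[of B 0 v] by auto

lemma normal_part_add: "normal_part B (v + w) = normal_part B v + normal_part B w"
proof (rule normal_part_eqI)
  show "v + w - (normal_part B v + normal_part B w) \<in> span B"
    using span_add[OF normal_part_spec(2) normal_part_spec(2), of v B w] by (simp add: algebra_simps)
qed (simp add: inner_add_left normal_part_spec)

section \<open>Conformal harmonic maps in one coordinate chart\<close>

lemma frechet_derivative_inner_eqD:
  assumes "open S" "p \<in> S" "\<And>q. q \<in> S \<Longrightarrow> f q \<bullet> k q = c"
    and "f differentiable at p" "k differentiable at p"
  shows "f p \<bullet> frechet_derivative k (at p) h + frechet_derivative f (at p) h \<bullet> k p = 0"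
proof -
  have "frechet_derivative (\<lambda>q. f q \<bullet> k q) (at p) h = 0"
    by (rule frechet_derivative_eq_0_open[OF assms(1-3)])
  then show ?thesis
    by (simp only: frechet_derivative_inner(1)[OF assms(4,5)])
qed

text \<open>The coordinate expression \<open>g\<close> of a conformal harmonic immersion into the sphere, with the inner
  products in the form in which they are differentiated below.\<close>

locale conformal_harmonic_chart =
  fixes S :: "complex set" and g :: "complex \<Rightarrow> real^7"
  assumes open_S: "open S"
    and smooth: "smooth_on g S"
    and unit: "p \<in> S \<Longrightarrow> g p \<bullet> g p = 1"
    and conf: "p \<in> S \<Longrightarrow> pdy g p \<bullet> pdy g p = pdx g p \<bullet> pdx g p"
    and orth: "p \<in> S \<Longrightarrow> pdx g p \<bullet> pdy g p = 0"
    and nondegenerate: "p \<in> S \<Longrightarrow> pdx g p \<bullet> pdx g p > 0"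
    and harmonic: "p \<in> S \<Longrightarrow> laplacian g p = (laplacian g p \<bullet> g p) *\<^sub>R g p"
begin

text \<open>The conformal factor.\<close>

abbreviation l :: "complex \<Rightarrow> real" where
  "l p \<equiv> pdx g p \<bullet> pdx g p"

lemma diff: "p \<in> S \<Longrightarrow> g differentiable at p"
  using smooth by (rule smooth_on_differentiable)

lemma diff_fd: "p \<in> S \<Longrightarrow> (\<lambda>q. frechet_derivative g (at q) h) differentiable at p"
  by (rule smooth_on_differentiable[OF smooth_on_frechet_derivative[OF smooth]])

lemma orth': "p \<in> S \<Longrightarrow> pdy g p \<bullet> pdx g p = 0"
  using orth by (simp add: inner_commute)

lemma commute: "p \<in> S \<Longrightarrow> pdx (pdy g) p = pdy (pdx g) p"
  using second_partials_commute[OF open_S smooth] .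

lemma g_fd: "p \<in> S \<Longrightarrow> g p \<bullet> frechet_derivative g (at p) h = 0"
  using frechet_derivative_inner_eqD[OF open_S _ unit diff diff, of p h] by (simp add: inner_commute)

lemma fd_g: "p \<in> S \<Longrightarrow> frechet_derivative g (at p) h \<bullet> g p = 0"
  using g_fd by (simp add: inner_commute)

text \<open>The second derivative of \<open>g \<bullet> g = 1\<close>.\<close>

lemma g_fd2: "p \<in> S \<Longrightarrow>
  g p \<bullet> frechet_derivative (\<lambda>q. frechet_derivative g (at q) k) (at p) h
    = - (frechet_derivative g (at p) h \<bullet> frechet_derivative g (at p) k)"
  using frechet_derivative_inner_eqD[OF open_S _ g_fd diff diff_fd, of p k h]
  by (simp add: add_eq_0_iff)

text \<open>A harmonic map into the sphere has Laplacian along \<open>g\<close>; the coefficient is obtained by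
  differentiating \<open>g \<bullet> g = 1\<close> twice.\<close>

lemma laplacian_eq: "p \<in> S \<Longrightarrow> laplacian g p = - (2 * l p) *\<^sub>R g p"
proof -
  assume p: "p \<in> S"
  have "laplacian g p \<bullet> g p = - (2 * l p)"
    using p by (simp add: laplacian_def inner_add_right inner_commute[of _ "g p"] g_fd2 conf)
  then show ?thesis
    using harmonic[OF p] by simp
qed

lemma pdyy_eq: "p \<in> S \<Longrightarrow> pdy (pdy g) p = - (2 * l p) *\<^sub>R g p - pdx (pdx g) p"
  using laplacian_eq[of p] unfolding laplacian_def by (metis add_diff_cancel_left')

lemma conf_derivative:
  assumes "p \<in> S"
  shows "frechet_derivative (\<lambda>q. pdy g q) (at p) h \<bullet> pdy g p = frechet_derivative (\<lambda>q. pdx g q) (at p) h \<bullet> pdx g p"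
proof -
  have "frechet_derivative (\<lambda>q. pdy g q \<bullet> pdy g q) (at p) h = frechet_derivative (\<lambda>q. pdx g q \<bullet> pdx g q) (at p) h"
    using frechet_derivative_cong_open[OF open_S assms conf] by simp
  then show ?thesis
    using assms by (simp add: frechet_derivative_inner diff_fd inner_commute)
qed

text \<open>The mixed partials agree, so three vectors carry the whole second derivative.\<close>

lemma second_derivative_expand:
  assumes "p \<in> S"
  shows "frechet_derivative (\<lambda>q. frechet_derivative g (at q) k) (at p) h =
    (Re h * Re k) *\<^sub>R pdx (pdx g) p + (Im h * Re k + Re h * Im k) *\<^sub>R pdy (pdx g) p
      + (Im h * Im k) *\<^sub>R pdy (pdy g) p"
proof -
  have "frechet_derivative (\<lambda>q. frechet_derivative g (at q) k) (at p) h
      = frechet_derivative (\<lambda>q. Re k *\<^sub>R pdx g q + Im k *\<^sub>R pdy g q) (at p) h"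
    using frechet_derivative_cong_open[OF open_S assms frechet_derivative_complex[OF diff]] by simp
  also have "\<dots> = Re k *\<^sub>R frechet_derivative (\<lambda>q. pdx g q) (at p) h
      + Im k *\<^sub>R frechet_derivative (\<lambda>q. pdy g q) (at p) h"
    by (simp add: frechet_derivative_add frechet_derivative_bounded_linear[OF bounded_linear_scaleR_right]
        diff_fd assms)
  also have "\<dots> = (Re h * Re k) *\<^sub>R pdx (pdx g) p + (Im h * Re k + Re h * Im k) *\<^sub>R pdy (pdx g) p
      + (Im h * Im k) *\<^sub>R pdy (pdy g) p"
    using frechet_derivative_complex[OF diff_fd[OF assms, of 1], of h]
      frechet_derivative_complex[OF diff_fd[OF assms, of \<i>], of h] commute[OF assms]
    by (simp only: scaleR_add_right scaleR_scaleR scaleR_add_left) (simp add: mult.commute)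
  finally show ?thesis .
qed

lemma totally_geodesic_iff:
  assumes "p \<in> S"
  shows "(\<forall>h k. second_fundamental_form 0 g p h k = 0) \<longleftrightarrow>
    {pdx (pdx g) p, pdy (pdx g) p, pdy (pdy g) p} \<subseteq> span {pdx g p, pdy g p, g p}"
proof
  assume "\<forall>h k. second_fundamental_form 0 g p h k = 0"
  then have "frechet_derivative (\<lambda>q. frechet_derivative g (at q) k) (at p) h \<in> span {pdx g p, pdy g p, g p}" for h k
    by (simp add: second_fundamental_form_def normal_part_eq_0_iff)
  then show "{pdx (pdx g) p, pdy (pdx g) p, pdy (pdy g) p} \<subseteq> span {pdx g p, pdy g p, g p}"
    by blast
next
  assume *: "{pdx (pdx g) p, pdy (pdx g) p, pdy (pdy g) p} \<subseteq> span {pdx g p, pdy g p, g p}"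
  have "frechet_derivative (\<lambda>q. frechet_derivative g (at q) k) (at p) h \<in> span {pdx g p, pdy g p, g p}" for h k
    by (subst second_derivative_expand[OF assms]) (use * in \<open>intro span_add span_scale; simp\<close>)
  then show "\<forall>h k. second_fundamental_form 0 g p h k = 0"
    unfolding second_fundamental_form_def normal_part_eq_0_iff diff_zero by blast
qed

end

locale conformal_harmonic_chart_primitive = conformal_harmonic_chart +
  fixes F :: "complex \<Rightarrow> real^7"
  assumes primitive: "p \<in> S \<Longrightarrow> (F has_derivative
    (\<lambda>h. Re h *\<^sub>R cross7 (g p) (pdy g p) - Im h *\<^sub>R cross7 (g p) (pdx g p))) (at p)"
begin

lemma F_derivative:
  assumes "p \<in> S"
  shows "frechet_derivative F (at p) h = Re h *\<^sub>R cross7 (g p) (pdy g p) - Im h *\<^sub>R cross7 (g p) (pdx g p)"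
    and "pdx F p = cross7 (g p) (pdy g p)" "pdy F p = - cross7 (g p) (pdx g p)"
    and "F differentiable at p"
  using has_derivative_imp_frechet[OF primitive[OF assms]] by simp_all

text \<open>The derivative of \<open>F\<close> is an expression in \<open>g\<close> and its derivative, hence smooth.\<close>

lemma smooth_F: "smooth_on F S"
proof (rule smooth_onI)
  show "smooth_on (\<lambda>q. frechet_derivative F (at q) h) S" for h
  proof (rule smooth_on_cong[OF open_S])
    show "smooth_on (\<lambda>q. Re h *\<^sub>R cross7 (g q) (pdy g q) + (- Im h) *\<^sub>R cross7 (g q) (pdx g q)) S"
      by (intro smooth_on_add smooth_on_bounded_linear[OF _ bounded_linear_scaleR_right]
          smooth_on_cross7 smooth_on_frechet_derivative open_S smooth)
  qed (simp add: F_derivative)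
qed (rule F_derivative(4))

text \<open>The map \<open>g \<times> _\<close> is an isometry of the complement of \<open>g\<close>, so that \<open>F\<close> is conformal with the same
  factor as \<open>g\<close>.\<close>

lemma F_metric:
  assumes "p \<in> S"
  shows "pdx F p \<bullet> pdx F p = l p" "pdy F p \<bullet> pdy F p = l p" "pdx F p \<bullet> pdy F p = 0"
  using assms by (simp_all add: F_derivative inner_cross7_cross7' unit g_fd conf orth')

lemma inj_F:
  assumes "p \<in> S"
  shows "inj (frechet_derivative F (at p))"
proof -
  interpret linear "frechet_derivative F (at p)"
    by (rule linear_frechet_derivative[OF F_derivative(4)[OF assms]])
  have "h = 0" if h: "frechet_derivative F (at p) h = 0" for h
  proof -
    have *: "Re h *\<^sub>R pdx F p + Im h *\<^sub>R pdy F p = 0"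
      using h frechet_derivative_complex[OF F_derivative(4)[OF assms]] by metis
    have "(Re h *\<^sub>R pdx F p + Im h *\<^sub>R pdy F p) \<bullet> pdx F p = Re h * l p"
         "(Re h *\<^sub>R pdx F p + Im h *\<^sub>R pdy F p) \<bullet> pdy F p = Im h * l p"
      using F_metric[OF assms] by (simp_all add: inner_add_left inner_commute[of "pdy F p" "pdx F p"])
    then show "h = 0"
      using * nondegenerate[OF assms] by (simp add: complex_eq_iff)
  qed
  then show ?thesis
    by (auto simp: inj_iff_eq_0)
qed

text \<open>The two terms \<open>g \<times> g\<^sub>x\<^sub>y\<close> have opposite signs and cancel.\<close>

lemma laplacian_F:
  assumes "p \<in> S"
  shows "laplacian F p = 2 *\<^sub>R cross7 (pdx g p) (pdy g p)"
proof -
  have "pdx (pdx F) p = pdx (\<lambda>q. cross7 (g q) (pdy g q)) p"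
    using frechet_derivative_cong_open[OF open_S assms F_derivative(2)] by simp
  moreover have "pdy (pdy F) p = pdy (\<lambda>q. - cross7 (g q) (pdx g q)) p"
    using frechet_derivative_cong_open[OF open_S assms F_derivative(3)] by simp
  moreover have "\<dots> = - pdy (\<lambda>q. cross7 (g q) (pdx g q)) p"
    using frechet_derivative_bounded_linear(1)[OF bounded_linear_minus[OF bounded_linear_ident]]
      frechet_derivative_cross7(2)[OF diff diff_fd] assms by blast
  ultimately show ?thesis
    using assms cross7_antisym[of "pdy g p" "pdx g p"]
    by (simp add: laplacian_def frechet_derivative_cross7(1) diff diff_fd commute scaleR_2)
qed

text \<open>The metric of \<open>F\<close> is diagonal, which reduces the trace of the second fundamental form to the
  normal part of the Laplacian.\<close>

lemma mean_curvature_F: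
  assumes "p \<in> S"
  shows "mean_curvature_vector c F p =
    (1 / (2 * l p)) *\<^sub>R normal_part {pdx F p, pdy F p, F p - c} (laplacian F p)"
proof -
  let ?N = "normal_part {pdx F p, pdy F p, F p - c}"
  have cancel: "1 / (2 * (L * L)) * L = 1 / (2 * L)" if "L > 0" for L :: real
    using that by simp
  have "mean_curvature_vector c F p =
      (1 / (2 * (l p * l p))) *\<^sub>R (l p *\<^sub>R ?N (pdx (pdx F) p) + l p *\<^sub>R ?N (pdy (pdy F) p))"
    unfolding mean_curvature_vector_def Let_def F_metric[OF assms] second_fundamental_form_def
    by simp
  also have "\<dots> = (1 / (2 * (l p * l p)) * l p) *\<^sub>R ?N (laplacian F p)"
    by (simp only: laplacian_def normal_part_add scaleR_add_right scaleR_scaleR)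
  also have "1 / (2 * (l p * l p)) * l p = 1 / (2 * l p)"
    using cancel[OF nondegenerate[OF assms]] .
  finally show ?thesis .
qed

lemma mean_curvature_F_0:
  assumes "p \<in> S" "laplacian F p = k *\<^sub>R (F p - c)"
  shows "mean_curvature_vector c F p = 0"
  using assms by (simp add: mean_curvature_F normal_part_eq_0_iff span_base span_scale)

text \<open>The Laplacian of \<open>F\<close> is orthogonal to the surface, so minimality makes it a multiple \<open>k\<close> of the
  radius vector \<open>F - c\<close>. Differentiating \<open>norm (F - c) = r\<close> twice gives \<open>k r\<^sup>2 = - 2 l\<close>, whereas
  the length of the Laplacian is \<open>2 l = \<bar>k\<bar> r\<close>. Hence \<open>r = 1\<close> and \<open>k = - 2 l\<close>.\<close>

lemma minimal_F_imp:
  assumes r: "r > 0" "\<And>q. q \<in> S \<Longrightarrow> norm (F q - c) = r"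
    and p: "p \<in> S" "mean_curvature_vector c F p = 0"
  shows "cross7 (pdx g p) (pdy g p) = - l p *\<^sub>R (F p - c)"
proof -
  let ?n = "F p - c" and ?D = "laplacian F p"
  have lp: "l p > 0"
    using nondegenerate[OF p(1)] .
  have "?D \<in> span {pdx F p, pdy F p, ?n}"
    using p lp by (simp add: mean_curvature_F normal_part_eq_0_iff)
  then obtain a b k where abk: "?D = a *\<^sub>R pdx F p + b *\<^sub>R pdy F p + k *\<^sub>R ?n"
    by (auto simp: span_insert span_breakdown_eq algebra_simps)
  have sq: "(F q - c) \<bullet> (F q - c) = r * r" if "q \<in> S" for q
    using r(2)[OF that] by (simp add: power2_norm_eq_inner[symmetric] power2_eq_square)
  have Dc: "(\<lambda>q. F q - c) differentiable at q" "frechet_derivative (\<lambda>q. F q - c) (at q) h = frechet_derivative F (at q) h"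
    if "q \<in> S" for q h
    using frechet_derivative_add[OF F_derivative(4)[OF that] differentiable_const, of "- c"]
      differentiable_add[OF F_derivative(4)[OF that] differentiable_const, of "- c"] by simp_all
  have tang: "(F q - c) \<bullet> frechet_derivative F (at q) h = 0" if "q \<in> S" for q h
    using frechet_derivative_inner_eqD[OF open_S that sq Dc(1)[OF that] Dc(1)[OF that], of h]
    by (simp add: Dc(2)[OF that] inner_commute)
  have dF: "(\<lambda>q. frechet_derivative F (at q) h) differentiable at p" for h
    by (rule smooth_on_differentiable[OF smooth_on_frechet_derivative[OF smooth_F] p(1)])
  have "?n \<bullet> frechet_derivative (\<lambda>q. frechet_derivative F (at q) h) (at p) h
      = - (frechet_derivative F (at p) h \<bullet> frechet_derivative F (at p) h)" for h
    using frechet_derivative_inner_eqD[OF open_S p(1) tang Dc(1)[OF p(1)] dF, of h h] Dc(2)[OF p(1)]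
    by simp
  then have nD: "?n \<bullet> ?D = - (2 * l p)"
    by (simp add: laplacian_def inner_add_right F_metric[OF p(1)])
  have "?D \<bullet> pdx F p = 0" "?D \<bullet> pdy F p = 0"
    using p(1) orth'[OF p(1)]
    by (simp_all add: laplacian_F F_derivative inner_cross7_cross7 inner_cross7_cross7' fd_g g_fd
        cross7_antisym[of "g p" "pdx g p"])
  then have "a = 0" "b = 0"
    using lp F_metric[OF p(1)] tang[OF p(1)]
    by (auto simp: abk inner_add_left inner_commute[of "pdy F p" "pdx F p"])
  then have D: "?D = k *\<^sub>R ?n"
    using abk by simp
  have krr: "k * (r * r) = - (2 * l p)"
    using nD sq[OF p(1)] by (simp add: D)
  have "?D \<bullet> ?D = 4 * (l p * l p)"
    using p(1) by (simp add: laplacian_F inner_cross7_cross7 conf orth)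
  then have "k * (k * (r * r)) = 4 * (l p * l p)"
    using sq[OF p(1)] by (simp add: D mult.assoc)
  then have "k * - (2 * l p) = 4 * (l p * l p)"
    unfolding krr .
  then have "(k + 2 * l p) * l p = 0"
    by (simp only: distrib_right mult_minus_right)
  then have "k = - (2 * l p)"
    using lp by (simp only: mult_eq_0_iff) linarith
  with D have "2 *\<^sub>R cross7 (pdx g p) (pdy g p) = 2 *\<^sub>R (- l p *\<^sub>R ?n)"
    unfolding laplacian_F[OF p(1)] by (simp only: scaleR_scaleR mult_minus_right)
  then show ?thesis
    by (simp only: scaleR_cancel_left) simp
qed

end

section \<open>Horizontal maps that are not full\<close>

text \<open>Orthogonal nonzero vectors are independent. A list saves one from discussing whether the vectors
  are distinct.\<close>

lemma length_le_dim_if_orthogonal: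
  fixes xs :: "'a::euclidean_space list"
  assumes "sorted_wrt (\<lambda>x y. x \<bullet> y = 0) xs" "0 \<notin> set xs"
  shows "length xs \<le> DIM('a)"
proof -
  have "distinct xs \<and> pairwise orthogonal (set xs)"
    using assms
  proof (induction xs)
    case (Cons x xs)
    then show ?case
      by (auto simp: pairwise_insert orthogonal_def inner_commute)
  qed simp
  then have "independent (set xs)" "length xs = card (set xs)"
    using assms(2) by (auto simp: pairwise_orthogonal_independent distinct_card)
  then show ?thesis
    using independent_bound by metis
qed

text \<open>If \<open>a\<close>, \<open>x\<close>, \<open>y\<close> span a Lagrangian subspace of the complex space \<open>v\<^sup>\<bottom>\<close> with complex structure
  \<open>v \<times> _\<close>, then together with their images and \<open>v\<close> they are seven orthogonal vectors, and an eighth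
  does not fit into the dimension 7.\<close>

lemma legendrian_frame_complete:
  fixes a x y v u :: "real^7"
  assumes v: "v \<bullet> v = 1" "a \<bullet> v = 0" "x \<bullet> v = 0" "y \<bullet> v = 0"
    and a: "a \<bullet> a > 0" "x \<bullet> x > 0" "y \<bullet> y > 0" "a \<bullet> x = 0" "a \<bullet> y = 0" "x \<bullet> y = 0"
    and J: "cross7 v a \<bullet> x = 0" "cross7 v a \<bullet> y = 0" "cross7 v x \<bullet> y = 0"
    and u: "u \<bullet> v = 0" "u \<bullet> a = 0" "u \<bullet> x = 0" "u \<bullet> y = 0"
      "u \<bullet> cross7 v a = 0" "u \<bullet> cross7 v x = 0" "u \<bullet> cross7 v y = 0"
  shows "u = 0"
proof (rule ccontr)
  assume "u \<noteq> 0"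
  have vv: "v \<bullet> a = 0" "v \<bullet> x = 0" "v \<bullet> y = 0"
    using v by (simp_all add: inner_commute)
  have Jn: "cross7 v a \<bullet> cross7 v a = a \<bullet> a" "cross7 v x \<bullet> cross7 v x = x \<bullet> x"
      "cross7 v y \<bullet> cross7 v y = y \<bullet> y" "cross7 v a \<bullet> cross7 v x = 0" "cross7 v a \<bullet> cross7 v y = 0"
      "cross7 v x \<bullet> cross7 v y = 0"
    by (simp_all add: inner_cross7_cross7' v vv a)
  have Js: "cross7 v x \<bullet> a = 0" "cross7 v y \<bullet> a = 0" "cross7 v y \<bullet> x = 0"
    using J inner_cross7_swap[of v a x] inner_cross7_swap[of v a y] inner_cross7_swap[of v x y] by simp_all
  have "sorted_wrt (\<lambda>x y. x \<bullet> y = 0) [u, v, a, x, y, cross7 v a, cross7 v x, cross7 v y]"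
    using u vv a Jn J Js by (simp add: inner_commute)
  moreover have "0 \<notin> set [u, v, a, x, y, cross7 v a, cross7 v x, cross7 v y]"
  proof -
    have "v \<noteq> 0" "a \<noteq> 0" "x \<noteq> 0" "y \<noteq> 0" "cross7 v a \<noteq> 0" "cross7 v x \<noteq> 0" "cross7 v y \<noteq> 0"
      using v(1) a(1-3) Jn(1-3) by (metis inner_zero_left less_irrefl zero_neq_one)+
    then show ?thesis
      using \<open>u \<noteq> 0\<close> by simp
  qed
  ultimately have "length [u, v, a, x, y, cross7 v a, cross7 v x, cross7 v y] \<le> DIM(real^7)"
    by (rule length_le_dim_if_orthogonal)
  then show False
    by simp
qed

lemma legendrian_frame_expansion:
  fixes a x y v u :: "real^7"
  assumes v: "v \<bullet> v = 1" "a \<bullet> v = 0" "x \<bullet> v = 0" "y \<bullet> v = 0"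
    and a: "a \<bullet> a = 1" "x \<bullet> x = m" "y \<bullet> y = m" "m > 0" "a \<bullet> x = 0" "a \<bullet> y = 0" "x \<bullet> y = 0"
    and J: "cross7 v a \<bullet> x = 0" "cross7 v a \<bullet> y = 0" "cross7 v x \<bullet> y = 0"
    and u: "u \<bullet> v = 0" "u \<bullet> cross7 v a = 0"
  shows "u = (u \<bullet> a) *\<^sub>R a + (u \<bullet> x / m) *\<^sub>R x + (u \<bullet> y / m) *\<^sub>R y
    + (u \<bullet> cross7 v x / m) *\<^sub>R cross7 v x + (u \<bullet> cross7 v y / m) *\<^sub>R cross7 v y"
    (is "u = ?r")
proof -
  have vv: "v \<bullet> a = 0" "v \<bullet> x = 0" "v \<bullet> y = 0" "x \<bullet> a = 0" "y \<bullet> a = 0" "y \<bullet> x = 0"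
    using v a by (simp_all add: inner_commute)
  have Jn: "cross7 v a \<bullet> cross7 v a = 1" "cross7 v x \<bullet> cross7 v x = m"
      "cross7 v y \<bullet> cross7 v y = m" "cross7 v a \<bullet> cross7 v x = 0" "cross7 v a \<bullet> cross7 v y = 0"
      "cross7 v x \<bullet> cross7 v y = 0" "cross7 v x \<bullet> cross7 v a = 0" "cross7 v y \<bullet> cross7 v a = 0"
      "cross7 v y \<bullet> cross7 v x = 0"
    by (simp_all add: inner_cross7_cross7' v vv a)
  have Js: "cross7 v x \<bullet> a = 0" "cross7 v y \<bullet> a = 0" "cross7 v y \<bullet> x = 0"
    using J inner_cross7_swap[of v a x] inner_cross7_swap[of v a y] inner_cross7_swap[of v x y] by simp_all
  have Jc: "a \<bullet> cross7 v x = 0" "a \<bullet> cross7 v y = 0" "x \<bullet> cross7 v y = 0"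
     "x \<bullet> cross7 v a = 0" "y \<bullet> cross7 v a = 0" "y \<bullet> cross7 v x = 0"
    using J Js by (simp_all add: inner_commute)
  have "u - ?r = 0"
    by (rule legendrian_frame_complete[OF v])
      (use a J in \<open>simp_all add: inner_diff_left inner_add_left v vv u Jn Js Jc J\<close>)
  then show ?thesis
    by simp
qed

context conformal_harmonic_chart
begin

text \<open>Under the hypotheses, \<open>g\<close>, \<open>g\<^sub>x\<close>, \<open>g\<^sub>y\<close>, their images \<open>X = v \<times> g\<^sub>x\<close>, \<open>Y = v \<times> g\<^sub>y\<close>, \<open>v \<times> g\<close>, and
  \<open>v\<close> form an orthogonal frame. Differentiating the orthogonality relations shows that the normal
  parts of \<open>g\<^sub>x\<^sub>x\<close> and \<open>g\<^sub>x\<^sub>y\<close> are \<open>(m X + n Y) / l\<close> and \<open>(n X - m Y) / l\<close> for two functions \<open>m\<close> and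
  \<open>n\<close>. Both are orthogonal to \<open>w\<close>, so where \<open>(m, n) \<noteq> 0\<close> also \<open>X\<close> and \<open>Y\<close> are. If that happens at
  \<open>p\<close>, it happens nearby, and differentiating once more shows that \<open>w\<close> is orthogonal to \<open>v \<times> g\<close> too.
  Then \<open>w\<close> is orthogonal to the whole frame, hence 0. So \<open>m\<close> and \<open>n\<close> vanish.\<close>

lemma horizontal_not_full_imp_totally_geodesic:
  assumes v: "v \<bullet> v = 1" "\<And>q. q \<in> S \<Longrightarrow> g q \<bullet> v = 0"
    and J: "\<And>q. q \<in> S \<Longrightarrow> cross7 v (g q) \<bullet> pdx g q = 0" "\<And>q. q \<in> S \<Longrightarrow> cross7 v (g q) \<bullet> pdy g q = 0"
      "\<And>q. q \<in> S \<Longrightarrow> cross7 v (pdx g q) \<bullet> pdy g q = 0"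
    and w: "w \<noteq> 0" "w \<bullet> v = 0" "\<And>q. q \<in> S \<Longrightarrow> g q \<bullet> w = 0"
    and p: "p \<in> S"
  shows "\<forall>h k. second_fundamental_form 0 g p h k = 0"
proof -
  define A where "A q = pdx (pdx g) q" for q
  define B where "B q = pdy (pdx g) q" for q
  define m where "m q = A q \<bullet> cross7 v (pdx g q)" for q
  define n where "n q = A q \<bullet> cross7 v (pdy g q)" for q
  define X where "X q = cross7 v (pdx g q)" for q
  define Y where "Y q = cross7 v (pdy g q)" for q
  have normal_const: "frechet_derivative g (at q) h \<bullet> u = 0"
      "frechet_derivative (\<lambda>q. frechet_derivative g (at q) h) (at q) k \<bullet> u = 0"
    if "\<And>q. q \<in> S \<Longrightarrow> g q \<bullet> u = 0" "q \<in> S" for q h k u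
  proof -
    have *: "frechet_derivative g (at q) h \<bullet> u = 0" if "q \<in> S" for q h
      using frechet_derivative_eq_0_open[where h = h, OF open_S that \<open>\<And>q. q \<in> S \<Longrightarrow> g q \<bullet> u = 0\<close>]
        frechet_derivative_bounded_linear(1)[where h = h, OF bounded_linear_inner_left[of u] diff[OF that]] by simp
    show "frechet_derivative g (at q) h \<bullet> u = 0"
      using * that by blast
    show "frechet_derivative (\<lambda>q. frechet_derivative g (at q) h) (at q) k \<bullet> u = 0"
      using frechet_derivative_eq_0_open[where h = k, OF open_S \<open>q \<in> S\<close> *[where h = h]]
        frechet_derivative_bounded_linear(1)[where h = k, OF bounded_linear_inner_left[of u] diff_fd[where h = h, OF \<open>q \<in> S\<close>]] by simp
  qed
  have dJ: "(\<lambda>q. cross7 v (frechet_derivative g (at q) h)) differentiable at q"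
      "frechet_derivative (\<lambda>q. cross7 v (frechet_derivative g (at q) h)) (at q) k =
        cross7 v (frechet_derivative (\<lambda>q. frechet_derivative g (at q) h) (at q) k)"
      "(\<lambda>q. cross7 v (g q)) differentiable at q"
      "frechet_derivative (\<lambda>q. cross7 v (g q)) (at q) k = cross7 v (frechet_derivative g (at q) k)"
    if "q \<in> S" for q h k
    using frechet_derivative_bounded_linear[OF cross7.bounded_linear_right[of v] diff_fd[OF that, of h]]
      frechet_derivative_bounded_linear[OF cross7.bounded_linear_right[of v] diff[OF that]] by simp_all
  have Av: "A q \<bullet> v = 0" "B q \<bullet> v = 0" "A q \<bullet> w = 0" "B q \<bullet> w = 0" if "q \<in> S" for q
    unfolding A_def B_def using normal_const(2)[OF v(2) that] normal_const(2)[OF w(3) that] by blast+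
  have fd: "pdx g q \<bullet> v = 0" "pdy g q \<bullet> v = 0" "pdx g q \<bullet> w = 0" "pdy g q \<bullet> w = 0" if "q \<in> S" for q
    using normal_const(1)[OF v(2) that] normal_const(1)[OF w(3) that] by blast+
  have swap: "cross7 v b \<bullet> c = - (b \<bullet> cross7 v c)" for b c
    using inner_cross7_swap[of v b c] by (simp add: inner_commute)
  have gX: "g q \<bullet> X q = 0" "g q \<bullet> Y q = 0" if "q \<in> S" for q
    using J(1,2)[OF that] by (simp_all add: X_def Y_def swap)
  have AJ: "A q \<bullet> cross7 v (g q) = 0" "B q \<bullet> cross7 v (g q) = 0" if q: "q \<in> S" for q
  proof -
    have "cross7 v (g q) \<bullet> frechet_derivative (\<lambda>q. pdx g q) (at q) h
        + cross7 v (frechet_derivative g (at q) h) \<bullet> pdx g q = 0" for h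
      using frechet_derivative_inner_eqD[OF open_S q J(1) dJ(3)[OF q] diff_fd[OF q], of h] dJ(4)[OF q] by simp
    from this[of 1] this[of \<i>] show "A q \<bullet> cross7 v (g q) = 0" "B q \<bullet> cross7 v (g q) = 0"
      using J(3)[OF q] inner_cross7_swap[of v "pdx g q" "pdy g q"]
      by (simp_all add: A_def B_def inner_commute)
  qed
  have Yx: "Y q \<bullet> pdx g q = 0" if "q \<in> S" for q
    using J(3)[OF that] inner_cross7_swap[of v "pdx g q" "pdy g q"] by (simp add: Y_def)
  have YJ: "Y q \<bullet> frechet_derivative (\<lambda>q. pdx g q) (at q) h
      + cross7 v (frechet_derivative (\<lambda>q. pdy g q) (at q) h) \<bullet> pdx g q = 0" if q: "q \<in> S" for q h
    using frechet_derivative_inner_eqD[OF open_S q Yx[unfolded Y_def] dJ(1)[OF q] diff_fd[OF q], of h] dJ(2)[OF q]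
    by (simp add: Y_def)
  have BX: "B q \<bullet> X q = n q" if q: "q \<in> S" for q
    using YJ[OF q, of 1] commute[OF q] by (simp add: swap A_def B_def X_def n_def Y_def inner_commute)
  have BY: "B q \<bullet> Y q = - m q" if q: "q \<in> S" for q
  proof -
    have "pdy (pdy g) q \<bullet> X q = - m q"
      unfolding pdyy_eq[OF q] using gX[OF q] by (simp add: inner_diff_left m_def A_def X_def)
    then show ?thesis
      using YJ[OF q, of \<i>] by (simp add: swap B_def X_def Y_def inner_commute)
  qed
  have expand: "u = (u \<bullet> g q) *\<^sub>R g q + (u \<bullet> pdx g q / l q) *\<^sub>R pdx g q + (u \<bullet> pdy g q / l q) *\<^sub>R pdy g q
      + (u \<bullet> X q / l q) *\<^sub>R X q + (u \<bullet> Y q / l q) *\<^sub>R Y q"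
    if "q \<in> S" "u \<bullet> v = 0" "u \<bullet> cross7 v (g q) = 0" for u q
    unfolding X_def Y_def
    by (rule legendrian_frame_expansion[OF v(1) v(2)[OF that(1)] fd(1,2)[OF that(1)] unit[OF that(1)] refl
          conf[OF that(1)] nondegenerate[OF that(1)] g_fd[OF that(1)] g_fd[OF that(1)] orth[OF that(1)]
          J[OF that(1)] that(2,3)])
  have kill: "(m q * m q + n q * n q) * (X q \<bullet> w) = 0" "(m q * m q + n q * n q) * (Y q \<bullet> w) = 0"
    if q: "q \<in> S" for q
  proof -
    have l: "l q > 0"
      using nondegenerate[OF q] .
    have "A q \<bullet> w = (m q / l q) * (X q \<bullet> w) + (n q / l q) * (Y q \<bullet> w)"
      by (subst expand[OF q Av(1)[OF q] AJ(1)[OF q]])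
        (simp add: inner_add_left fd[OF q] w(3)[OF q] m_def n_def X_def Y_def)
    then have 1: "m q * (X q \<bullet> w) + n q * (Y q \<bullet> w) = 0"
      using l Av(3)[OF q] by (simp add: field_simps)
    have "B q \<bullet> w = (n q / l q) * (X q \<bullet> w) - (m q / l q) * (Y q \<bullet> w)"
      by (subst expand[OF q Av(2)[OF q] AJ(2)[OF q]])
        (simp add: inner_add_left inner_diff_left fd[OF q] w(3)[OF q] BX[OF q] BY[OF q])
    then have 2: "n q * (X q \<bullet> w) - m q * (Y q \<bullet> w) = 0"
      using l Av(4)[OF q] by (simp add: field_simps)
    have "(m q * m q + n q * n q) * (X q \<bullet> w) = m q * (m q * (X q \<bullet> w) + n q * (Y q \<bullet> w))
        + n q * (n q * (X q \<bullet> w) - m q * (Y q \<bullet> w))"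
      by (simp add: algebra_simps)
    then show "(m q * m q + n q * n q) * (X q \<bullet> w) = 0"
      by (simp add: 1 2)
    have "(m q * m q + n q * n q) * (Y q \<bullet> w) = n q * (m q * (X q \<bullet> w) + n q * (Y q \<bullet> w))
        - m q * (n q * (X q \<bullet> w) - m q * (Y q \<bullet> w))"
      by (simp add: algebra_simps)
    then show "(m q * m q + n q * n q) * (Y q \<bullet> w) = 0"
      by (simp add: 1 2)
  qed
  define k where "k q = m q * m q + n q * n q" for q
  \<comment> \<open>Otherwise \<open>w\<close> is orthogonal to \<open>X\<close> and \<open>Y\<close> on a neighbourhood, so that the relations can be
    differentiated again; the sum of the second derivatives is a multiple of \<open>g\<close>.\<close>
  have "k p = 0"
  proof (rule ccontr)
    assume kp: "k p \<noteq> 0"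
    define T where "T = {q \<in> S. k q \<noteq> 0}"
    have cont: "continuous_on S (\<lambda>q. frechet_derivative g (at q) h)"
        "continuous_on S A" for h
      unfolding A_def by (intro smooth_on_continuous smooth_on_frechet_derivative smooth)+
    have "continuous_on S k"
      unfolding k_def m_def n_def
      by (intro continuous_intros cross7.continuous_on cont)
    then have "open (S \<inter> k -` (- {0}))"
      using open_S by (intro continuous_open_preimage) auto
    also have "S \<inter> k -` (- {0}) = T"
      by (auto simp: T_def)
    finally have T: "open T" .
    have pT: "p \<in> T"
      using kp p by (simp add: T_def)
    have XY: "X q \<bullet> w = 0" "Y q \<bullet> w = 0" if "q \<in> T" for q
      using kill[of q] that by (auto simp: T_def k_def)
    have dT: "cross7 v (frechet_derivative (\<lambda>q. frechet_derivative g (at q) h) (at p) h) \<bullet> w = 0"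
      if "\<And>q. q \<in> T \<Longrightarrow> cross7 v (frechet_derivative g (at q) h) \<bullet> w = 0" for h
      using frechet_derivative_eq_0_open[where h = h, OF T pT that]
        frechet_derivative_bounded_linear(1)[where h = h, OF bounded_linear_inner_left[of w] dJ(1)[where h = h, OF p]] dJ(2)[OF p]
      by simp
    have "cross7 v (pdx (pdx g) p) \<bullet> w = 0" "cross7 v (pdy (pdy g) p) \<bullet> w = 0"
      using dT[of 1] dT[of \<i>] XY by (simp_all add: X_def Y_def)
    then have "l p * (cross7 v (g p) \<bullet> w) = 0"
      unfolding pdyy_eq[OF p]
      by (simp add: cross7.diff_right cross7.minus_right cross7.scaleR_right inner_diff_left)
    then have "cross7 v (g p) \<bullet> w = 0"
      using nondegenerate[OF p] by simp
    moreover have "pdx g p \<noteq> 0"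
      using nondegenerate[OF p] by auto
    ultimately have "w = 0"
      using XY[OF pT] w(2,3) p fd(3,4)[OF p]
      by (intro legendrian_frame_complete[OF v(1) v(2)[OF p] fd(1,2)[OF p], of w])
        (simp_all add: unit conf nondegenerate g_fd orth J X_def Y_def inner_commute[of w])
    then show False
      using w(1) by simp
  qed
  then have mn: "m p = 0" "n p = 0"
    by (auto simp: k_def sum_squares_eq_zero_iff)
  let ?T = "{pdx g p, pdy g p, g p}"
  have tangent: "u \<in> span ?T" if "u \<bullet> v = 0" "u \<bullet> cross7 v (g p) = 0" "u \<bullet> X p = 0" "u \<bullet> Y p = 0" for u
    by (subst expand[OF p that(1,2)]) (simp add: that(3,4) span_add span_scale span_base)
  have "A p \<in> span ?T"
    using Av(1)[OF p] AJ(1)[OF p] mn by (intro tangent) (simp_all add: m_def n_def X_def Y_def)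
  moreover have "B p \<in> span ?T"
    using Av(2)[OF p] AJ(2)[OF p] mn BX[OF p] BY[OF p] by (intro tangent) simp_all
  moreover have "pdy (pdy g) p \<in> span ?T"
    unfolding pdyy_eq[OF p] A_def[symmetric]
    using \<open>A p \<in> span ?T\<close> by (intro span_diff span_scale) (simp_all add: span_base)
  ultimately show ?thesis
    unfolding totally_geodesic_iff[OF p] A_def B_def by simp
qed

end

section \<open>The map F in the three cases, in one chart\<close>

text \<open>For \<open>\<sigma> = 1\<close> this is the equation of almost complex curves, for \<open>\<sigma> = -1\<close> the one for the opposite
  orientation; one real equation is enough because \<open>f \<times> _\<close> squares to \<open>-1\<close> on tangent vectors.\<close>

lemma complex_linear_of_pdy:
  assumes D: "f differentiable at p" and f: "f p \<bullet> f p = 1" "f p \<bullet> pdx f p = 0"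
    and s: "\<sigma> * \<sigma> = 1" and J: "pdy f p = \<sigma> *\<^sub>R cross7 (f p) (pdx f p)"
  shows "frechet_derivative f (at p) (\<i> * h) = \<sigma> *\<^sub>R cross7 (f p) (frechet_derivative f (at p) h)"
proof -
  have y: "cross7 (f p) (pdy f p) = - \<sigma> *\<^sub>R pdx f p"
    by (simp add: J f cross7.scaleR_right cross7_cross7_same)
  have y': "\<sigma> *\<^sub>R cross7 (f p) (pdy f p) = - pdx f p"
    by (simp add: y s)
  have "\<sigma> *\<^sub>R cross7 (f p) (frechet_derivative f (at p) h)
      = Re h *\<^sub>R \<sigma> *\<^sub>R cross7 (f p) (pdx f p) + Im h *\<^sub>R \<sigma> *\<^sub>R cross7 (f p) (pdy f p)"
    unfolding frechet_derivative_complex[OF D, of h]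
    by (simp add: cross7.add_right cross7.scaleR_right scaleR_add_right mult.commute)
  also have "\<dots> = Re h *\<^sub>R pdy f p - Im h *\<^sub>R pdx f p"
    unfolding y' J[symmetric] by simp
  also have "\<dots> = frechet_derivative f (at p) (\<i> * h)"
    using frechet_derivative_complex[OF D, of "\<i> * h"] by simp
  finally show ?thesis
    by simp
qed

context conformal_harmonic_chart_primitive
begin

text \<open>The unit vector \<open>N = c - F\<close> is the normalized \<open>g\<^sub>x \<times> g\<^sub>y\<close>, so that \<open>g\<^sub>x\<close>, \<open>g\<^sub>y\<close> and \<open>N\<close> multiply like a
  quaternionic triple. Since \<open>N\<^sub>x = - g \<times> g\<^sub>y\<close> and \<open>N\<^sub>y = g \<times> g\<^sub>x\<close>, the two product rules cancel
  completely.\<close>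

lemma Gauss_map_derivatives:
  assumes N: "\<And>q. q \<in> S \<Longrightarrow> cross7 (pdx g q) (pdy g q) = - l q *\<^sub>R (F q - c)" and p: "p \<in> S"
  shows "(c - F p) \<bullet> (c - F p) = 1"
    and "(c - F p) \<bullet> pdx g p = 0" "(c - F p) \<bullet> pdy g p = 0"
    and "((\<lambda>q. g q \<bullet> (c - F q)) has_derivative (\<lambda>h. 0)) (at p)"
    and "((\<lambda>q. cross7 (g q) (c - F q)) has_derivative (\<lambda>h. 0)) (at p)"
proof -
  let ?N = "c - F p" and ?x = "pdx g p" and ?y = "pdy g p"
  have lp: "l p > 0"
    using nondegenerate[OF p] .
  have xy: "cross7 ?x ?y = l p *\<^sub>R ?N"
    using N[OF p] by (simp add: algebra_simps)
  have "l p * l p * (?N \<bullet> ?N) = cross7 ?x ?y \<bullet> cross7 ?x ?y"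
    by (simp add: xy)
  also have "\<dots> = l p * l p * 1"
    using p by (simp add: inner_cross7_cross7 conf orth)
  finally show NN: "?N \<bullet> ?N = 1"
    using lp by (simp only: mult_cancel_left) simp
  have "l p * (?N \<bullet> ?x) = cross7 ?x ?y \<bullet> ?x" "l p * (?N \<bullet> ?y) = cross7 ?x ?y \<bullet> ?y"
    by (simp_all add: xy)
  then show Nx: "?N \<bullet> ?x = 0" "?N \<bullet> ?y = 0"
    using lp by simp_all
  have "l p *\<^sub>R cross7 ?x ?N = l p *\<^sub>R - ?y"
    using cross7_cross7_same[of ?x ?y] orth[OF p] by (simp add: xy cross7.scaleR_right)
  then have xN: "cross7 ?x ?N = - ?y"
    using lp by (simp only: scaleR_cancel_left) simp
  have "l p *\<^sub>R cross7 ?y ?N = l p *\<^sub>R ?x"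
    using cross7_cross7_same[of ?y ?x] cross7_antisym[of ?x ?y] orth'[OF p] conf[OF p]
    by (simp add: xy[symmetric] cross7.minus_right flip: cross7.scaleR_right)
  then have yN: "cross7 ?y ?N = ?x"
    using lp by (simp only: scaleR_cancel_left) simp
  have gxy: "cross7 (g p) (cross7 (g p) ?x) = - ?x" "cross7 (g p) (cross7 (g p) ?y) = - ?y"
    using p by (simp_all add: cross7_cross7_same g_fd unit)
  have dg: "(g has_derivative (\<lambda>h. Re h *\<^sub>R ?x + Im h *\<^sub>R ?y)) (at p)"
    using has_derivative_frechet[OF diff[OF p]] frechet_derivative_complex[OF diff[OF p]]
    by (metis (no_types, lifting) has_derivative_eq_rhs ext)
  have dN: "((\<lambda>q. c - F q) has_derivative (\<lambda>h. - (Re h *\<^sub>R cross7 (g p) ?y - Im h *\<^sub>R cross7 (g p) ?x))) (at p)"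
    by (rule has_derivative_eq_rhs[OF has_derivative_diff[OF has_derivative_const primitive[OF p]]]) simp
  have gN: "g p \<bullet> (Im h *\<^sub>R cross7 (g p) ?x - Re h *\<^sub>R cross7 (g p) ?y) = 0" for h
    by (simp add: inner_diff_right)
  have gcN: "cross7 (g p) (Im h *\<^sub>R cross7 (g p) ?x - Re h *\<^sub>R cross7 (g p) ?y) = Re h *\<^sub>R ?y - Im h *\<^sub>R ?x" for h
    by (simp add: cross7.diff_right cross7.scaleR_right gxy)
  show "((\<lambda>q. g q \<bullet> (c - F q)) has_derivative (\<lambda>h. 0)) (at p)"
    by (rule has_derivative_eq_rhs[OF has_derivative_inner[OF dg dN]])
      (use Nx gN in \<open>simp add: fun_eq_iff inner_add_left inner_add_right inner_commute[of _ ?N]\<close>)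
  show "((\<lambda>q. cross7 (g q) (c - F q)) has_derivative (\<lambda>h. 0)) (at p)"
    by (rule has_derivative_eq_rhs[OF cross7.FDERIV[OF dg dN]])
      (simp add: fun_eq_iff cross7.add_left cross7.scaleR_left gcN xN yN)
qed

text \<open>The Laplacian of \<open>g\<close> is proportional to \<open>g\<close>, and a linear image inherits this.\<close>

lemma F_derivatives_if_linear_image:
  assumes F: "\<And>q. q \<in> S \<Longrightarrow> F q = d + L (g q)" and L: "bounded_linear L" and p: "p \<in> S"
  shows "frechet_derivative F (at p) h = L (frechet_derivative g (at p) h)"
    and "laplacian F p = - (2 * l p) *\<^sub>R (F p - d)"
proof -
  have fd: "frechet_derivative F (at q) h = L (frechet_derivative g (at q) h)" if q: "q \<in> S" for q h
  proof -
    have "frechet_derivative F (at q) h = frechet_derivative (\<lambda>q. d + L (g q)) (at q) h"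
      using frechet_derivative_cong_open[OF open_S q F] by simp
    then show ?thesis
      using frechet_derivative_add[OF differentiable_const[of d] frechet_derivative_bounded_linear(2)[OF L diff[OF q]], of h]
        frechet_derivative_bounded_linear(1)[OF L diff[OF q], of h] by simp
  qed
  show "frechet_derivative F (at p) h = L (frechet_derivative g (at p) h)"
    using fd[OF p] .
  have fd2: "frechet_derivative (\<lambda>q. frechet_derivative F (at q) h) (at p) k
      = L (frechet_derivative (\<lambda>q. frechet_derivative g (at q) h) (at p) k)" for h k
    using frechet_derivative_cong_open[OF open_S p fd[where h = h]]
      frechet_derivative_bounded_linear(1)[where h = k, OF L diff_fd[where h = h, OF p]] by simp
  interpret L: bounded_linear L
    by (rule L)
  have "laplacian F p = L (laplacian g p)"
    by (simp add: laplacian_def fd2 L.add)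
  then show "laplacian F p = - (2 * l p) *\<^sub>R (F p - d)"
    unfolding laplacian_eq[OF p] using F[OF p] by (simp add: L.scaleR L.neg)
qed

lemma almost_complex_imp_F_derivative:
  assumes s: "\<sigma> * \<sigma> = 1" and J: "pdy g p = \<sigma> *\<^sub>R cross7 (g p) (pdx g p)" and p: "p \<in> S"
  shows "frechet_derivative F (at p) h = - \<sigma> *\<^sub>R frechet_derivative g (at p) h"
proof -
  have "cross7 (g p) (pdx g p) = \<sigma> *\<^sub>R pdy g p"
    by (simp add: J s)
  moreover have "cross7 (g p) (pdy g p) = - \<sigma> *\<^sub>R pdx g p"
    using p by (simp add: J cross7.scaleR_right cross7_cross7_same g_fd unit)
  ultimately show ?thesis
    by (subst frechet_derivative_complex[OF diff[OF p]])
      (simp add: F_derivative[OF p] algebra_simps)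
qed

text \<open>The equation of \<open>\<psi>\<close> says in particular that \<open>\<psi> \<times> \<psi>\<^sub>x\<close> is orthogonal to \<open>v\<close>. Therefore the rotation
  by \<open>\<beta>\<close> turns \<open>\<psi> \<times> \<psi>\<^sub>x = \<sigma> \<psi>\<^sub>y\<close> into \<open>g \<times> g\<^sub>x = \<sigma> rot7 v (- 3 \<beta>) g\<^sub>y\<close>: it acts on the product by the
  angle \<open>-2\<beta>\<close>, and on the derivative by \<open>\<beta>\<close>.\<close>

lemma rotated_almost_complex_imp_F_derivative:
  assumes v: "norm v = 1" and \<psi>: "\<And>q. q \<in> S \<Longrightarrow> \<psi> differentiable at q" "\<And>q. q \<in> S \<Longrightarrow> \<psi> q \<bullet> v = 0"
    and g: "\<And>q. q \<in> S \<Longrightarrow> g q = rot7 v \<beta> (\<psi> q)"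
    and s: "\<sigma> * \<sigma> = 1" and J: "pdy \<psi> p = \<sigma> *\<^sub>R cross7 (\<psi> p) (pdx \<psi> p)" and p: "p \<in> S"
  shows "frechet_derivative F (at p) h = - \<sigma> *\<^sub>R rot7 v (- 3 * \<beta>) (frechet_derivative g (at p) h)"
proof -
  have fd: "frechet_derivative g (at p) h = rot7 v \<beta> (frechet_derivative \<psi> (at p) h)" for h
    using frechet_derivative_cong_open[OF open_S p g]
      frechet_derivative_bounded_linear(1)[OF bounded_linear_rot7 \<psi>(1)[OF p]] by simp
  have fdv: "frechet_derivative \<psi> (at p) h \<bullet> v = 0" for h
    using frechet_derivative_eq_0_open[where h = h, OF open_S p \<psi>(2)]
      frechet_derivative_bounded_linear(1)[where h = h, OF bounded_linear_inner_left[of v] \<psi>(1)[OF p]] by simp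
  have un: "\<psi> p \<bullet> \<psi> p = 1" and tan: "\<psi> p \<bullet> frechet_derivative \<psi> (at p) h = 0" for h
    using unit[OF p] g_fd[OF p, of h] by (simp_all add: fd g[OF p] inner_rot7_rot7[OF v])
  have x: "cross7 (\<psi> p) (pdx \<psi> p) = \<sigma> *\<^sub>R pdy \<psi> p"
    by (simp add: J s)
  have y: "cross7 (\<psi> p) (pdy \<psi> p) = - \<sigma> *\<^sub>R pdx \<psi> p"
    using tan[of 1] by (simp add: J cross7.scaleR_right cross7_cross7_same un)
  interpret R: bounded_linear "rot7 v b" for b
    by (rule bounded_linear_rot7)
  have R: "rot7 v (- 2 * \<beta>) u = rot7 v (- 3 * \<beta>) (rot7 v \<beta> u)" if "u \<bullet> v = 0" for u
    using rot7_rot7[OF v that, of "- 3 * \<beta>" \<beta>] by simp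
  have gx: "cross7 (g p) (pdx g p) = \<sigma> *\<^sub>R rot7 v (- 3 * \<beta>) (pdy g p)"
    unfolding fd g[OF p]
    using cross7_rot7_rot7[OF v \<psi>(2)[OF p] fdv tan, of 1 \<beta>] fdv
    by (simp only: x R R.scaleR inner_scaleR_left mult_zero_right)
  have gy: "cross7 (g p) (pdy g p) = - \<sigma> *\<^sub>R rot7 v (- 3 * \<beta>) (pdx g p)"
    unfolding fd g[OF p]
    using cross7_rot7_rot7[OF v \<psi>(2)[OF p] fdv tan, of \<i> \<beta>] fdv
    by (simp only: y R R.scaleR inner_scaleR_left mult_zero_right)
  show ?thesis
    by (subst frechet_derivative_complex[OF diff[OF p]])
      (simp add: F_derivative[OF p] gx gy R.add R.scaleR algebra_simps)
qed

text \<open>The second derivatives of \<open>g\<close> are tangent to the cone over the surface. Their components along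
  \<open>g\<^sub>x\<close> and \<open>g\<^sub>y\<close> only rescale \<open>g\<^sub>x \<times> g\<^sub>y\<close>, as the derivative of \<open>l\<close> does, and the normalization removes this;
  the components along \<open>g\<close> contribute \<open>- g \<times> g\<^sub>y\<close> and \<open>g \<times> g\<^sub>x\<close>, the negative of the derivative of \<open>F\<close>.\<close>

lemma totally_geodesic_imp_Gauss_map_derivative:
  assumes p: "p \<in> S" and tg: "\<forall>h k. second_fundamental_form 0 g p h k = 0"
  shows "((\<lambda>q. F q + (1 / l q) *\<^sub>R cross7 (pdx g q) (pdy g q)) has_derivative (\<lambda>h. 0)) (at p)"
proof -
  let ?x = "pdx g p" and ?y = "pdy g p" and ?M = "cross7 (pdx g p) (pdy g p)"
  have lp: "l p > 0"
    using nondegenerate[OF p] .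
  have comb: "u = (u \<bullet> ?x / l p) *\<^sub>R ?x + (u \<bullet> ?y / l p) *\<^sub>R ?y + (u \<bullet> g p) *\<^sub>R g p"
    if u: "u \<in> span {?x, ?y, g p}" for u
  proof -
    obtain a b c where "u - a *\<^sub>R ?x - b *\<^sub>R ?y - c *\<^sub>R g p = 0"
      using u by (auto simp: span_breakdown_eq)
    then have "u = a *\<^sub>R ?x + b *\<^sub>R ?y + c *\<^sub>R g p"
      by (simp add: algebra_simps)
    moreover from this have "u \<bullet> ?x = a * l p" "u \<bullet> ?y = b * l p" "u \<bullet> g p = c"
      using p by (simp_all add: inner_add_left orth orth' g_fd fd_g conf unit)
    ultimately show ?thesis
      using lp by simp
  qed
  define dx where "dx h = frechet_derivative (\<lambda>q. pdx g q) (at p) h" for h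
  define dy where "dy h = frechet_derivative (\<lambda>q. pdy g q) (at p) h" for h
  have span: "dx h \<in> span {?x, ?y, g p}" "dy h \<in> span {?x, ?y, g p}" for h
    using tg unfolding second_fundamental_form_def normal_part_eq_0_iff dx_def dy_def by simp_all
  have M': "cross7 ?x (dy h) + cross7 (dx h) ?y
      = (2 * (dx h \<bullet> ?x) / l p) *\<^sub>R ?M - (?x \<bullet> frechet_derivative g (at p) h) *\<^sub>R cross7 (g p) ?y
        + (?y \<bullet> frechet_derivative g (at p) h) *\<^sub>R cross7 (g p) ?x" for h
  proof -
    have "dx h \<bullet> g p = - (?x \<bullet> frechet_derivative g (at p) h)" "dy h \<bullet> g p = - (?y \<bullet> frechet_derivative g (at p) h)"
      using g_fd2[OF p] by (simp_all add: dx_def dy_def inner_commute)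
    then have eqs: "cross7 ?x (dy h) = (dx h \<bullet> ?x / l p) *\<^sub>R ?M + (?y \<bullet> frechet_derivative g (at p) h) *\<^sub>R cross7 (g p) ?x"
      "cross7 (dx h) ?y = (dx h \<bullet> ?x / l p) *\<^sub>R ?M - (?x \<bullet> frechet_derivative g (at p) h) *\<^sub>R cross7 (g p) ?y"
      using conf_derivative[OF p, of h, folded dx_def dy_def]
      by (subst comb[OF span(2)] comb[OF span(1)],
          simp add: cross7.add_left cross7.add_right cross7.diff_left cross7.diff_right cross7.scaleR_left
          cross7.minus_right cross7.scaleR_right cross7_antisym[of ?x "g p"])+
    have two: "(2 * (dx h \<bullet> ?x) / l p) *\<^sub>R ?M = (dx h \<bullet> ?x / l p) *\<^sub>R ?M + (dx h \<bullet> ?x / l p) *\<^sub>R ?M"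
      by (simp flip: scaleR_add_left)
    show ?thesis
      unfolding eqs two by simp
  qed
  have xh: "?x \<bullet> frechet_derivative g (at p) h = Re h * l p" "?y \<bullet> frechet_derivative g (at p) h = Im h * l p" for h
    using p by (simp_all add: frechet_derivative_complex[OF diff[OF p], of h] inner_add_right conf orth orth')
  have dM: "((\<lambda>q. cross7 (pdx g q) (pdy g q)) has_derivative (\<lambda>h. cross7 ?x (dy h) + cross7 (dx h) ?y)) (at p)"
    unfolding dx_def dy_def by (rule has_derivative_frechet_bilinear[OF bounded_bilinear_cross7 diff_fd[OF p] diff_fd[OF p]])
  have dl: "((\<lambda>q. l q) has_derivative (\<lambda>h. 2 * (dx h \<bullet> ?x))) (at p)"
    unfolding dx_def
    by (rule has_derivative_eq_rhs[OF has_derivative_frechet_bilinear[OF bounded_bilinear_inner diff_fd[OF p] diff_fd[OF p]]])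
      (simp add: inner_commute fun_eq_iff)
  have dli: "((\<lambda>q. inverse (l q)) has_derivative (\<lambda>h. - (inverse (l p) * (2 * (dx h \<bullet> ?x)) * inverse (l p)))) (at p)"
    using lp by (intro Deriv.has_derivative_inverse dl) simp
  have "((\<lambda>q. F q + inverse (l q) *\<^sub>R cross7 (pdx g q) (pdy g q)) has_derivative (\<lambda>h. 0)) (at p)"
  proof (rule has_derivative_eq_rhs[OF has_derivative_add[OF primitive[OF p] has_derivative_scaleR[OF dli dM]]], rule ext)
    fix h
    have c: "inverse L * (2 * d / L) = inverse L * (2 * d) * inverse L" "inverse L * (e * L) = e"
      if "L > 0" for L d e :: real
      using that by (simp_all add: field_simps)
    show "Re h *\<^sub>R cross7 (g p) ?y - Im h *\<^sub>R cross7 (g p) ?x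
      + (inverse (l p) *\<^sub>R (cross7 ?x (dy h) + cross7 (dx h) ?y)
        + - (inverse (l p) * (2 * (dx h \<bullet> ?x)) * inverse (l p)) *\<^sub>R ?M) = 0"
      unfolding M'[of h] xh[of h] scaleR_add_right scaleR_diff_right scaleR_scaleR c[OF lp] by simp
  qed
  then show ?thesis
    by (simp add: inverse_eq_divide)
qed

end

context conformal_harmonic_chart
begin

text \<open>Rotating \<open>g\<close> by \<open>\<alpha>\<close> changes the product by \<open>-2\<alpha>\<close> and the derivative by \<open>\<alpha>\<close>, which absorbs the
  twist \<open>3\<alpha>\<close> exactly.\<close>

lemma untwist_almost_complex:
  assumes v: "norm v = 1" and gv: "\<And>q. q \<in> S \<Longrightarrow> g q \<bullet> v = 0"
    and J: "\<And>q. q \<in> S \<Longrightarrow> cross7 (g q) (pdx g q) = rot7 v (3 * \<alpha>) (pdy g q)" and p: "p \<in> S"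
  defines "\<psi> \<equiv> \<lambda>q. rot7 v \<alpha> (g q)"
  shows "frechet_derivative \<psi> (at p) (\<i> * h) = cross7 (\<psi> p) (frechet_derivative \<psi> (at p) h)"
proof -
  have D: "\<psi> differentiable at p" and fd: "frechet_derivative \<psi> (at p) h = rot7 v \<alpha> (frechet_derivative g (at p) h)" for h
    unfolding \<psi>_def using frechet_derivative_bounded_linear[OF bounded_linear_rot7 diff[OF p]] by blast+
  have fdv: "frechet_derivative g (at p) h \<bullet> v = 0" for h
    using frechet_derivative_eq_0_open[where h = h, OF open_S p gv]
      frechet_derivative_bounded_linear(1)[where h = h, OF bounded_linear_inner_left[of v] diff[OF p]] by simp
  have "cross7 (g p) (pdx g p) \<bullet> v = 0"
    by (simp add: J[OF p] rot7_inner_axis[OF v] fdv)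
  from cross7_rot7_rot7[OF v gv[OF p] fdv g_fd[OF p] this, of \<alpha>]
  have x: "cross7 (\<psi> p) (pdx \<psi> p) = pdy \<psi> p"
    using rot7_rot7[OF v fdv, of "- 2 * \<alpha>" "3 * \<alpha>" \<i>] by (simp add: fd J[OF p]) (simp add: \<psi>_def)
  have "\<psi> p \<bullet> pdx \<psi> p = 0" "\<psi> p \<bullet> \<psi> p = 1"
    unfolding fd using p by (simp_all add: \<psi>_def inner_rot7_rot7[OF v] g_fd unit)
  then show ?thesis
    using complex_linear_of_pdy[OF D, of 1 h] x by simp
qed

end

section \<open>Globalization over the surface\<close>

lemma comp_inv_into_cnj: "f \<circ> inv_into U (cnj \<circ> z) = (f \<circ> inv_into U z) \<circ> cnj"
proof -
  have "inv_into U (cnj \<circ> z) q = inv_into U z (cnj q)" for q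
  proof -
    have "(cnj \<circ> z) x = q \<longleftrightarrow> z x = cnj q" for x
      by (metis comp_apply complex_cnj_cnj)
    then show ?thesis
      by (simp add: inv_into_def)
  qed
  then show ?thesis
    by (simp add: fun_eq_iff)
qed

text \<open>The coordinate expression of a map in a conjugate chart is the old one composed with conjugation,
  so conditions for the conjugate atlas can be read in the charts of the given one.\<close>

lemma everywhere_local_conj_atlas:
  "everywhere_local (conj_atlas A) P f \<longleftrightarrow> everywhere_local A (\<lambda>g p. P (g \<circ> cnj) (cnj p)) f"
proof -
  have "everywhere_local (conj_atlas A) P f \<longleftrightarrow>
      (\<forall>(U, z)\<in>A. \<forall>p\<in>(cnj \<circ> z) ` U. P (f \<circ> inv_into U (cnj \<circ> z)) p)"
    by (auto simp: everywhere_local_def conj_atlas_def)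
  then show ?thesis
    unfolding everywhere_local_def comp_inv_into_cnj image_comp[symmetric] by (simp add: case_prod_beta)
qed

context riemann_surface
begin

lemma inv_chart: "(U, z) \<in> A \<Longrightarrow> x \<in> U \<Longrightarrow> inv_into U z (z x) = x"
  using chart_homeomorphism homeomorphism_apply1 by metis

lemma chart_at:
  obtains U z where "(U, z) \<in> A" "x \<in> U"
  using covering by (metis (mono_tags, lifting) UNIV_I UN_E case_prod_conv prod.exhaust_sel)

lemma smooth_map_conj_atlas: "smooth_map (conj_atlas A) f \<longleftrightarrow> smooth_map A f"
proof -
  have "smooth_on (k \<circ> cnj) (cnj ` S) \<longleftrightarrow> smooth_on k S" if "open S" for S and k :: "complex \<Rightarrow> 'b"
    using Ck_on_compose_cnj[OF that, of _ k] Ck_on_compose_cnj[OF open_cnj_image[OF that], of _ "k \<circ> cnj"]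
    by (auto simp: smooth_on_def comp_assoc image_comp o_def)
  then have "smooth_on (f \<circ> inv_into U (cnj \<circ> z)) ((cnj \<circ> z) ` U) \<longleftrightarrow> smooth_on (f \<circ> inv_into U z) (z ` U)"
    if "(U, z) \<in> A" for U z
    unfolding comp_inv_into_cnj image_comp[symmetric] using chart_image_open[OF that] by simp
  moreover have "smooth_map (conj_atlas A) f \<longleftrightarrow>
      (\<forall>(U, z)\<in>A. smooth_on (f \<circ> inv_into U (cnj \<circ> z)) ((cnj \<circ> z) ` U))"
    by (auto simp: smooth_map_def conj_atlas_def)
  ultimately show ?thesis
    by (auto simp: smooth_map_def)
qed

text \<open>The function is constant on coordinate discs and the surface is connected.\<close>

lemma constant_if_derivative_0:
  fixes f :: "'a \<Rightarrow> 'b::real_normed_vector"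
  assumes "\<And>U z p. (U, z) \<in> A \<Longrightarrow> p \<in> z ` U \<Longrightarrow> ((f \<circ> inv_into U z) has_derivative (\<lambda>h. 0)) (at p)"
  shows "\<exists>c. \<forall>x. f x = c"
proof -
  have "f constant_on UNIV"
  proof (rule locally_constant_imp_constant[OF connected])
    fix x :: 'a
    obtain U z where U: "(U, z) \<in> A" "x \<in> U"
      by (rule chart_at)
    obtain e where e: "e > 0" "ball (z x) e \<subseteq> z ` U"
      using chart_image_open[OF U(1)] U(2) openE by blast
    define T where "T = U \<inter> z -` ball (z x) e"
    have "continuous_on U z"
      using chart_homeomorphism[OF U(1)] homeomorphism_def by blast
    then have "open T"
      unfolding T_def using chart_open[OF U(1)] by (intro continuous_open_preimage) auto
    moreover have "x \<in> T"
      using U e by (simp add: T_def)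
    moreover have "f y = f x" if "y \<in> T" for y
    proof -
      have "(f \<circ> inv_into U z) (z y) = (f \<circ> inv_into U z) (z x)"
      proof (rule has_derivative_zero_unique_connected[of "ball (z x) e"])
        show "(f \<circ> inv_into U z has_derivative (\<lambda>h. 0)) (at p)" if "p \<in> ball (z x) e" for p
          using that e by (intro assms[OF U(1)]) blast
        show "z y \<in> ball (z x) e" "z x \<in> ball (z x) e"
          using that e(1) by (simp_all add: T_def)
      qed simp_all
      moreover have "inv_into U z (z y) = y" "inv_into U z (z x) = x"
        using that U(2) by (auto simp: T_def intro!: inv_chart[OF U(1)])
      ultimately show ?thesis
        by simp
    qed
    ultimately show "\<exists>T. openin (top_of_set UNIV) T \<and> x \<in> T \<and> (\<forall>y\<in>T. f y = f x)"
      unfolding subtopology_UNIV open_openin[symmetric] by blast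
  qed
  then show ?thesis
    by (auto simp: constant_on_def)
qed

end

locale conformal_harmonic_immersion = riemann_surface A
  for A :: "('a::t2_space) chart set" +
  fixes \<phi> F :: "'a \<Rightarrow> real^7"
  assumes immersion: "immersion A \<phi>"
    and conformal: "conformal A \<phi>"
    and harmonic: "harmonic_into_unit_sphere A \<phi>"
    and primitive: "is_cross_star_primitive A \<phi> F"
begin

lemma norm_\<phi>: "norm (\<phi> x) = 1"
  using harmonic by (auto simp: harmonic_into_unit_sphere_def image_subset_iff)

lemma chart:
  assumes U: "(U, z) \<in> A"
  shows "conformal_harmonic_chart_primitive (z ` U) (\<phi> \<circ> inv_into U z) (F \<circ> inv_into U z)"
proof
  let ?g = "\<phi> \<circ> inv_into U z"
  show "open (z ` U)"
    using chart_image_open[OF U] .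
  show sm: "smooth_on ?g (z ` U)"
    using immersion U by (auto simp: immersion_def smooth_map_def)
  fix p assume p: "p \<in> z ` U"
  show "?g p \<bullet> ?g p = 1"
    using norm_\<phi> by (simp add: norm_eq_1)
  have "norm (pdx ?g p) = norm (pdy ?g p) \<and> pdx ?g p \<bullet> pdy ?g p = 0"
    using conformal U p by (auto simp: conformal_def everywhere_local_def)
  then show "pdy ?g p \<bullet> pdy ?g p = pdx ?g p \<bullet> pdx ?g p" "pdx ?g p \<bullet> pdy ?g p = 0"
    by (simp_all add: norm_eq)
  have "inj (frechet_derivative ?g (at p))"
    using immersion U p by (auto simp: immersion_def everywhere_local_def)
  then have "frechet_derivative ?g (at p) 1 \<noteq> frechet_derivative ?g (at p) 0"
    by (metis injD zero_neq_one)
  moreover have "frechet_derivative ?g (at p) 0 = 0"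
    by (rule linear_0[OF linear_frechet_derivative[OF smooth_on_differentiable[OF sm p]]])
  ultimately show "pdx ?g p \<bullet> pdx ?g p > 0"
    by simp
  have "laplacian ?g p - (laplacian ?g p \<bullet> ?g p) *\<^sub>R ?g p = 0"
    using harmonic U p by (auto simp: harmonic_into_unit_sphere_def everywhere_local_def)
  then show "laplacian ?g p = (laplacian ?g p \<bullet> ?g p) *\<^sub>R ?g p"
    by simp
  show "(F \<circ> inv_into U z has_derivative
    (\<lambda>h. Re h *\<^sub>R cross7 (?g p) (pdy ?g p) - Im h *\<^sub>R cross7 (?g p) (pdx ?g p))) (at p)"
    using primitive U p by (auto simp: is_cross_star_primitive_def Let_def)
qed

lemma minimal_in_sphereI:
  assumes "\<And>x. norm (F x - c) = 1"
    and "\<And>U z p. (U, z) \<in> A \<Longrightarrow> p \<in> z ` U \<Longrightarrow>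
      \<exists>k. laplacian (F \<circ> inv_into U z) p = k *\<^sub>R ((F \<circ> inv_into U z) p - c)"
  shows "minimal_in_sphere A c 1 F"
  unfolding minimal_in_sphere_def immersion_def
proof (intro conjI)
  show "smooth_map A F"
    unfolding smooth_map_def
    using conformal_harmonic_chart_primitive.smooth_F[OF chart] by auto
  show "everywhere_local A (\<lambda>g p. inj (frechet_derivative g (at p))) F"
    unfolding everywhere_local_def
    using conformal_harmonic_chart_primitive.inj_F[OF chart] by fast
  show "range F \<subseteq> sphere c 1"
    using assms(1) by (auto simp: dist_norm norm_minus_commute)
  show "everywhere_local A (\<lambda>g p. mean_curvature_vector c g p = 0) F"
    unfolding everywhere_local_def
    using conformal_harmonic_chart_primitive.mean_curvature_F_0[OF chart] assms(2) by fast
qed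

text \<open>Then \<open>F\<close> is a translate of \<open>L \<circ> \<phi>\<close>, and the Laplacian of \<open>\<phi>\<close> is parallel to \<open>\<phi>\<close>.\<close>

lemma minimal_if_F_derivative:
  assumes L: "bounded_linear L" and norm: "\<And>x. norm (L (\<phi> x)) = 1"
    and fd: "\<And>U z p h. (U, z) \<in> A \<Longrightarrow> p \<in> z ` U \<Longrightarrow>
      frechet_derivative (F \<circ> inv_into U z) (at p) h = L (frechet_derivative (\<phi> \<circ> inv_into U z) (at p) h)"
  shows "\<exists>c. minimal_in_sphere A c 1 F"
proof -
  interpret L: bounded_linear L
    by (rule L)
  have "((\<lambda>x. F x - L (\<phi> x)) \<circ> inv_into U z has_derivative (\<lambda>h. 0)) (at p)"
    if U: "(U, z) \<in> A" "p \<in> z ` U" for U z p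
  proof -
    interpret conformal_harmonic_chart_primitive "z ` U" "\<phi> \<circ> inv_into U z" "F \<circ> inv_into U z"
      by (rule chart[OF U(1)])
    have "((\<lambda>q. (F \<circ> inv_into U z) q - L ((\<phi> \<circ> inv_into U z) q)) has_derivative
        (\<lambda>h. frechet_derivative (F \<circ> inv_into U z) (at p) h - L (frechet_derivative (\<phi> \<circ> inv_into U z) (at p) h))) (at p)"
      by (intro has_derivative_diff L.has_derivative has_derivative_frechet F_derivative(4)[OF U(2)] diff[OF U(2)])
    then show ?thesis
      unfolding fd[OF U] by (simp add: o_def)
  qed
  then obtain c where "\<And>x. F x - L (\<phi> x) = c"
    using constant_if_derivative_0[of "\<lambda>x. F x - L (\<phi> x)"] by blast
  then have F: "F x = c + L (\<phi> x)" for x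
    by (metis add.commute diff_add_cancel)
  have "minimal_in_sphere A c 1 F"
  proof (rule minimal_in_sphereI)
    show "norm (F x - c) = 1" for x
      by (simp add: F norm)
    fix U z p assume U: "(U, z) \<in> A" "p \<in> z ` U"
    show "\<exists>k. laplacian (F \<circ> inv_into U z) p = k *\<^sub>R ((F \<circ> inv_into U z) p - c)"
      by (rule exI) (rule conformal_harmonic_chart_primitive.F_derivatives_if_linear_image(2)[OF chart[OF U(1)] _ L U(2)],
        simp add: F)
  qed
  then show ?thesis ..
qed

text \<open>The sign \<open>\<sigma>\<close> records which of the two orientations is used, so that both can be treated at once
  in the charts of \<open>A\<close>.\<close>

lemma almost_complex_curve_imp_local:
  assumes "almost_complex_curve B \<psi>" "B \<in> {A, conj_atlas A}"
  shows "\<exists>\<sigma>. \<sigma> * \<sigma> = 1 \<and> everywhere_local A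
    (\<lambda>g p. g differentiable at p \<and> pdy g p = \<sigma> *\<^sub>R cross7 (g p) (pdx g p)) \<psi>"
proof -
  let ?J = "\<lambda>g p. \<forall>h. frechet_derivative g (at p) (\<i> * h) = cross7 (g p) (frechet_derivative g (at p) h)"
  have "smooth_map A \<psi>"
    using assms smooth_map_conj_atlas by (auto simp: almost_complex_curve_def)
  then have D: "(\<psi> \<circ> inv_into U z) differentiable at p" if "(U, z) \<in> A" "p \<in> z ` U" for U z p
    using that by (auto simp: smooth_map_def intro: smooth_on_differentiable)
  have J: "everywhere_local B ?J \<psi>"
    using assms(1) by (simp add: almost_complex_curve_def)
  show ?thesis
  proof (cases "B = A")
    case True
    have "pdy (\<psi> \<circ> inv_into U z) p = 1 *\<^sub>R cross7 ((\<psi> \<circ> inv_into U z) p) (pdx (\<psi> \<circ> inv_into U z) p)"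
      if U: "(U, z) \<in> A" "p \<in> z ` U" for U z p
    proof -
      have "?J (\<psi> \<circ> inv_into U z) p"
        using U J True by (auto simp: everywhere_local_def)
      from this[rule_format, of 1]
      show ?thesis
        by simp
    qed
    then show ?thesis
      using D by (intro exI[of _ 1]) (auto simp: everywhere_local_def)
  next
    case False
    then have "B = conj_atlas A"
      using assms(2) by simp
    from J[unfolded this everywhere_local_conj_atlas]
    have "everywhere_local A (\<lambda>g p. ?J (g \<circ> cnj) (cnj p)) \<psi>" .
    have "pdy (\<psi> \<circ> inv_into U z) p = - 1 *\<^sub>R cross7 ((\<psi> \<circ> inv_into U z) p) (pdx (\<psi> \<circ> inv_into U z) p)"
      if U: "(U, z) \<in> A" "p \<in> z ` U" for U z p
    proof -
      let ?g = "\<psi> \<circ> inv_into U z"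
      have "?J (?g \<circ> cnj) (cnj p)"
        using \<open>everywhere_local A (\<lambda>g p. ?J (g \<circ> cnj) (cnj p)) \<psi>\<close> U by (auto simp: everywhere_local_def)
      from this[rule_format, of 1]
      have "frechet_derivative ?g (at p) (- \<i>) = cross7 (?g p) (pdx ?g p)"
        using frechet_derivative_compose_cnj(1)[of ?g "cnj p"] D[OF U] by simp
      then have "cross7 (?g p) (pdx ?g p) = - pdy ?g p"
        using frechet_derivative_complex[OF D[OF U], of "- \<i>"] by simp
      then show ?thesis
        by simp
    qed
    then show ?thesis
      using D by (intro exI[of _ "- 1"]) (auto simp: everywhere_local_def)
  qed
qed

lemma minimal_if_almost_complex:
  assumes "almost_complex_curve B \<phi>" "B \<in> {A, conj_atlas A}"
  shows "\<exists>c. minimal_in_sphere A c 1 F"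
proof -
  obtain \<sigma> where s: "\<sigma> * \<sigma> = 1" and loc: "everywhere_local A
      (\<lambda>g p. g differentiable at p \<and> pdy g p = \<sigma> *\<^sub>R cross7 (g p) (pdx g p)) \<phi>"
    using almost_complex_curve_imp_local[OF assms] by blast
  have J: "pdy (\<phi> \<circ> inv_into U z) p = \<sigma> *\<^sub>R cross7 ((\<phi> \<circ> inv_into U z) p) (pdx (\<phi> \<circ> inv_into U z) p)"
    if "(U, z) \<in> A" "p \<in> z ` U" for U z p
    using loc that by (auto simp: everywhere_local_def)
  show ?thesis
  proof (rule minimal_if_F_derivative[of "\<lambda>x. - \<sigma> *\<^sub>R x"])
    have "\<bar>\<sigma>\<bar> = 1"
      using s by (auto simp: square_eq_1_iff)
    then show "norm (- \<sigma> *\<^sub>R \<phi> x) = 1" for x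
      by (simp add: norm_\<phi>)
    show "bounded_linear (\<lambda>x :: real^7. - \<sigma> *\<^sub>R x)"
      by (rule bounded_linear_scaleR_right)
  qed (rule conformal_harmonic_chart_primitive.almost_complex_imp_F_derivative[OF chart s J])
qed

lemma minimal_if_rotated_almost_complex:
  assumes "almost_complex_curve B \<psi>" "B \<in> {A, conj_atlas A}" and v: "norm v = 1"
    and \<psi>: "\<And>x. \<psi> x \<bullet> v = 0" "\<phi> = rot7 v \<beta> \<circ> \<psi>"
  shows "\<exists>c. minimal_in_sphere A c 1 F"
proof -
  obtain \<sigma> where s: "\<sigma> * \<sigma> = 1" and loc: "everywhere_local A
      (\<lambda>g p. g differentiable at p \<and> pdy g p = \<sigma> *\<^sub>R cross7 (g p) (pdx g p)) \<psi>"
    using almost_complex_curve_imp_local[OF assms(1,2)] by blast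
  have D: "(\<psi> \<circ> inv_into U z) differentiable at p"
    and J: "pdy (\<psi> \<circ> inv_into U z) p = \<sigma> *\<^sub>R cross7 ((\<psi> \<circ> inv_into U z) p) (pdx (\<psi> \<circ> inv_into U z) p)"
    if "(U, z) \<in> A" "p \<in> z ` U" for U z p
    using loc that by (auto simp: everywhere_local_def)
  show ?thesis
  proof (rule minimal_if_F_derivative[of "\<lambda>x. - \<sigma> *\<^sub>R rot7 v (- 3 * \<beta>) x"])
    have "norm (rot7 v b x) = norm x" for b x
      by (simp add: norm_eq inner_rot7_rot7[OF v])
    moreover have "\<bar>\<sigma>\<bar> = 1"
      using s by (auto simp: square_eq_1_iff)
    ultimately show "norm (- \<sigma> *\<^sub>R rot7 v (- 3 * \<beta>) (\<phi> x)) = 1" for x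
      by (simp add: norm_\<phi>)
    show "bounded_linear (\<lambda>x. - \<sigma> *\<^sub>R rot7 v (- 3 * \<beta>) x)"
      by (rule bounded_linear_compose[OF bounded_linear_scaleR_right bounded_linear_rot7])
    fix U z p h assume U: "(U, z) \<in> A" "p \<in> z ` U"
    show "frechet_derivative (F \<circ> inv_into U z) (at p) h
        = - \<sigma> *\<^sub>R rot7 v (- 3 * \<beta>) (frechet_derivative (\<phi> \<circ> inv_into U z) (at p) h)"
      by (rule conformal_harmonic_chart_primitive.rotated_almost_complex_imp_F_derivative
          [OF chart[OF U(1)] v, of "\<psi> \<circ> inv_into U z"])
        (use U D J s \<psi> in auto)
  qed
qed

end

context conformal_harmonic_immersion
begin

text \<open>Conjugating the coordinate only changes the sign of \<open>g\<^sub>y\<close>, which does not affect the spans of the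
  tangent vectors.\<close>

lemma totally_geodesic_imp_local:
  assumes "totally_geodesic_in_sphere B 0 1 \<phi>" "B \<in> {A, conj_atlas A}" and U: "(U, z) \<in> A" "p \<in> z ` U"
  shows "\<forall>h k. second_fundamental_form 0 (\<phi> \<circ> inv_into U z) p h k = 0"
proof -
  let ?II = "\<lambda>g p. \<forall>h k. second_fundamental_form 0 g p h k = 0"
  let ?g = "\<phi> \<circ> inv_into U z"
  have "everywhere_local B ?II \<phi>"
    using assms(1) by (simp add: totally_geodesic_in_sphere_def)
  then have "?II ?g p \<or> ?II (?g \<circ> cnj) (cnj p)"
    using assms(2) everywhere_local_conj_atlas[of A ?II \<phi>] U by (auto simp: everywhere_local_def)
  moreover have "?II ?g p" if "?II (?g \<circ> cnj) (cnj p)"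
  proof (intro allI)
    fix h k
    interpret conformal_harmonic_chart_primitive "z ` U" ?g "F \<circ> inv_into U z"
      by (rule chart[OF U(1)])
    have fd: "frechet_derivative (?g \<circ> cnj) (at q) h = ((\<lambda>q. frechet_derivative ?g (at q) (cnj h)) \<circ> cnj) q"
      if "q \<in> cnj ` z ` U" for q h
      using that by (auto simp: frechet_derivative_compose_cnj(1) diff)
    have fdk: "frechet_derivative (?g \<circ> cnj) (at q) (cnj k) = ((\<lambda>q. frechet_derivative ?g (at q) k) \<circ> cnj) q"
      if "q \<in> cnj ` z ` U" for q
      using fd[OF that, of "cnj k"] by simp
    have cp: "cnj p \<in> cnj ` z ` U"
      using U(2) by blast
    have "frechet_derivative (\<lambda>q. frechet_derivative (?g \<circ> cnj) (at q) (cnj k)) (at (cnj p)) (cnj h)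
        = frechet_derivative ((\<lambda>q. frechet_derivative ?g (at q) k) \<circ> cnj) (at (cnj p)) (cnj h)"
      by (rule fun_cong[OF frechet_derivative_cong_open[OF open_cnj_image[OF open_S] cp fdk]])
    also have "\<dots> = frechet_derivative (\<lambda>q. frechet_derivative ?g (at q) k) (at p) h"
      using frechet_derivative_compose_cnj(1)[of "\<lambda>q. frechet_derivative ?g (at q) k" "cnj p" "cnj h"]
        diff_fd[OF U(2), of k] by simp
    also have "frechet_derivative (\<lambda>q. frechet_derivative (?g \<circ> cnj) (at q) (cnj k)) (at (cnj p)) (cnj h)
        \<in> span {pdx (?g \<circ> cnj) (cnj p), pdy (?g \<circ> cnj) (cnj p), (?g \<circ> cnj) (cnj p) - 0}"
      using that unfolding second_fundamental_form_def normal_part_eq_0_iff by blast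
    moreover have "pdx (?g \<circ> cnj) (cnj p) = pdx ?g p" "pdy (?g \<circ> cnj) (cnj p) = - pdy ?g p"
      using fd[OF cp] frechet_derivative_complex[OF diff[OF U(2)], of "- \<i>"] by simp_all
    moreover have "span {pdx ?g p, - pdy ?g p, ?g p - 0} \<subseteq> span {pdx ?g p, pdy ?g p, ?g p - 0}"
      by (rule span_minimal) (auto intro: span_base span_neg)
    ultimately show "second_fundamental_form 0 ?g p h k = 0"
      unfolding second_fundamental_form_def normal_part_eq_0_iff by auto
  qed
  ultimately show ?thesis
    by blast
qed

text \<open>The normalized vector \<open>g\<^sub>x \<times> g\<^sub>y\<close> at a point, computed in a chart that contains the point.\<close>

definition Gauss_map :: "'a chart \<Rightarrow> 'a \<Rightarrow> real^7" where
  "Gauss_map = (\<lambda>(U, z) x. let g = \<phi> \<circ> inv_into U z; p = z x in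
     (1 / (pdx g p \<bullet> pdx g p)) *\<^sub>R cross7 (pdx g p) (pdy g p))"

text \<open>If \<open>d\<close> is the derivative of the coordinate change, both \<open>g\<^sub>x \<times> g\<^sub>y\<close> and the conformal factor are
  multiplied by \<open>\<bar>d\<bar>\<^sup>2\<close>.\<close>

lemma Gauss_map_chart_independent:
  assumes U: "(U, z) \<in> A" "x \<in> U" and V: "(V, w) \<in> A" "x \<in> V"
  shows "Gauss_map (U, z) x = Gauss_map (V, w) x"
proof -
  let ?g = "\<phi> \<circ> inv_into U z" and ?k = "\<phi> \<circ> inv_into V w"
  interpret g: conformal_harmonic_chart_primitive "z ` U" ?g "F \<circ> inv_into U z"
    by (rule chart[OF U(1)])
  interpret k: conformal_harmonic_chart_primitive "w ` V" ?k "F \<circ> inv_into V w"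
    by (rule chart[OF V(1)])
  define \<tau> where "\<tau> = w \<circ> inv_into U z"
  let ?S = "z ` (U \<inter> V)"
  have "openin (top_of_set U) (U \<inter> V)"
    using chart_open[OF V(1)] by auto
  from homeomorphism_imp_open_map[OF chart_homeomorphism[OF U(1)] this]
  have open_S: "open ?S"
    using chart_image_open[OF U(1)] openin_open_trans by blast
  have zx: "z x \<in> ?S" "z x \<in> z ` U" "w x \<in> w ` V"
    using U V by auto
  have \<tau>x: "\<tau> (z x) = w x"
    using inv_chart[OF U] by (simp add: \<tau>_def)
  have gk: "?g q = (?k \<circ> \<tau>) q" if "q \<in> ?S" for q
  proof -
    obtain y where y: "y \<in> U" "y \<in> V" "q = z y"
      using \<open>q \<in> ?S\<close> by blast
    then show ?thesis
      using inv_chart[OF U(1) y(1)] inv_chart[OF V(1) y(2)] by (simp add: \<tau>_def)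
  qed
  have "\<tau> field_differentiable at (z x)"
    using transition_holomorphic[OF U(1) V(1)] zx(1) open_S
    unfolding \<tau>_def by (simp add: holomorphic_on_imp_differentiable_at)
  then obtain d where d: "(\<tau> has_derivative (*) d) (at (z x))"
    by (auto simp: field_differentiable_def has_field_derivative_def)
  have "(?k has_derivative frechet_derivative ?k (at (w x))) (at (\<tau> (z x)))"
    using has_derivative_frechet[OF k.diff[OF zx(3)]] by (simp add: \<tau>x)
  then have "frechet_derivative (?k \<circ> \<tau>) (at (z x)) h = frechet_derivative ?k (at (w x)) (d * h)" for h
    by (simp only: has_derivative_imp_frechet(1)[OF diff_chain_at[OF d]] comp_apply)
  then have fd: "frechet_derivative ?g (at (z x)) h = frechet_derivative ?k (at (w x)) (d * h)" for h
    using frechet_derivative_cong_open[where f = ?g and k = "?k \<circ> \<tau>", OF open_S zx(1) gk] by simp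
  let ?X = "pdx ?k (w x)" and ?Y = "pdy ?k (w x)"
  have x: "pdx ?g (z x) = Re d *\<^sub>R ?X + Im d *\<^sub>R ?Y"
    using frechet_derivative_complex[OF k.diff[OF zx(3)], of d] by (simp add: fd)
  have y: "pdy ?g (z x) = - Im d *\<^sub>R ?X + Re d *\<^sub>R ?Y"
    using frechet_derivative_complex[OF k.diff[OF zx(3)], of "d * \<i>"] by (simp add: fd)
  define m where "m = Re d * Re d + Im d * Im d"
  have "g.l (z x) = m * k.l (w x)"
    unfolding x m_def using k.conf[OF zx(3)] k.orth[OF zx(3)] k.orth'[OF zx(3)]
    by (simp add: inner_add_left inner_add_right algebra_simps)
  moreover have "cross7 (pdx ?g (z x)) (pdy ?g (z x)) = m *\<^sub>R cross7 ?X ?Y"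
    unfolding x y m_def using cross7_antisym[of ?Y ?X]
    by (simp add: cross7.add_left cross7.add_right cross7.diff_right cross7.scaleR_left
        cross7.scaleR_right algebra_simps)
  moreover have "m \<noteq> 0"
    using g.nondegenerate[OF zx(2)] calculation(1) by auto
  ultimately show ?thesis
    by (simp add: Gauss_map_def Let_def)
qed

text \<open>The sum of \<open>F\<close> and the Gauss map is constant, so that \<open>F - c\<close> is a unit vector parallel to the
  Laplacian of \<open>F\<close>.\<close>

lemma minimal_if_totally_geodesic:
  assumes "totally_geodesic_in_sphere B 0 1 \<phi>" "B \<in> {A, conj_atlas A}"
  shows "\<exists>c. minimal_in_sphere A c 1 F"
proof -
  define N where "N x = Gauss_map (SOME (U, z). (U, z) \<in> A \<and> x \<in> U) x" for x
  have N: "N x = Gauss_map (U, z) x" if U: "(U, z) \<in> A" "x \<in> U" for U z x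
  proof -
    obtain V w where Vw: "(SOME (U, z). (U, z) \<in> A \<and> x \<in> U) = (V, w)"
      by fastforce
    have "case (V, w) of (U, z) \<Rightarrow> (U, z) \<in> A \<and> x \<in> U"
      unfolding Vw[symmetric] by (rule someI[of _ "(U, z)"]) (use U in simp)
    then show ?thesis
      using Gauss_map_chart_independent[OF _ _ U] by (simp add: N_def Vw)
  qed
  have Np: "N (inv_into U z p) = (1 / (pdx (\<phi> \<circ> inv_into U z) p \<bullet> pdx (\<phi> \<circ> inv_into U z) p)) *\<^sub>R
      cross7 (pdx (\<phi> \<circ> inv_into U z) p) (pdy (\<phi> \<circ> inv_into U z) p)"
    if U: "(U, z) \<in> A" "p \<in> z ` U" for U z p
    using N[OF U(1) inv_into_into[OF U(2)]] f_inv_into_f[OF U(2)] by (simp add: Gauss_map_def Let_def)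
  have "((\<lambda>x. F x + N x) \<circ> inv_into U z has_derivative (\<lambda>h. 0)) (at p)" if U: "(U, z) \<in> A" "p \<in> z ` U" for U z p
  proof -
    interpret conformal_harmonic_chart_primitive "z ` U" "\<phi> \<circ> inv_into U z" "F \<circ> inv_into U z"
      by (rule chart[OF U(1)])
    show ?thesis
      by (rule has_derivative_transform_within_open[OF
            totally_geodesic_imp_Gauss_map_derivative[OF U(2) totally_geodesic_imp_local[OF assms U]] open_S U(2)])
        (simp add: Np[OF U(1)])
  qed
  then obtain c where c: "\<And>x. F x + N x = c"
    using constant_if_derivative_0[of "\<lambda>x. F x + N x"] by blast
  then have FN: "F x - c = - N x" for x
    by (metis add_diff_cancel_left' minus_diff_eq)
  have "minimal_in_sphere A c 1 F"
  proof (rule minimal_in_sphereI)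
    fix x
    obtain U z where U: "(U, z) \<in> A" "x \<in> U"
      by (rule chart_at)
    interpret conformal_harmonic_chart_primitive "z ` U" "\<phi> \<circ> inv_into U z" "F \<circ> inv_into U z"
      by (rule chart[OF U(1)])
    have p: "z x \<in> z ` U"
      using U by blast
    have "N x \<bullet> N x = 1"
      using Np[OF U(1) p] nondegenerate[OF p] inner_cross7_cross7[of "pdx (\<phi> \<circ> inv_into U z) (z x)"] orth[OF p] conf[OF p]
      by (simp add: inv_chart[OF U])
    then show "norm (F x - c) = 1"
      by (simp add: FN norm_eq_1)
  next
    fix U z p assume U: "(U, z) \<in> A" "p \<in> z ` U"
    interpret conformal_harmonic_chart_primitive "z ` U" "\<phi> \<circ> inv_into U z" "F \<circ> inv_into U z"
      by (rule chart[OF U(1)])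
    have "laplacian (F \<circ> inv_into U z) p = - (2 * l p) *\<^sub>R ((F \<circ> inv_into U z) p - c)"
      using nondegenerate[OF U(2)] by (simp add: laplacian_F[OF U(2)] FN Np[OF U])
    then show "\<exists>k. laplacian (F \<circ> inv_into U z) p = k *\<^sub>R ((F \<circ> inv_into U z) p - c)"
      by blast
  qed
  then show ?thesis ..
qed

lemma almost_complex_curveI:
  assumes "smooth_map A \<psi>" "\<And>x. norm (\<psi> x) = 1" and "\<And>c. \<not> (\<forall>x. \<psi> x = c)"
    and "\<And>U z p h. (U, z) \<in> A \<Longrightarrow> p \<in> z ` U \<Longrightarrow> frechet_derivative (\<psi> \<circ> inv_into U z) (at p) (\<i> * h)
      = cross7 ((\<psi> \<circ> inv_into U z) p) (frechet_derivative (\<psi> \<circ> inv_into U z) (at p) h)"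
  shows "almost_complex_curve A \<psi>"
  using assms unfolding almost_complex_curve_def everywhere_local_def constant_on_def by auto

lemma \<phi>_not_constant: "\<not> (\<forall>x. \<phi> x = c)"
proof
  assume c: "\<forall>x. \<phi> x = c"
  obtain U z where U: "(U, z) \<in> A" "undefined \<in> U"
    by (rule chart_at)
  interpret conformal_harmonic_chart_primitive "z ` U" "\<phi> \<circ> inv_into U z" "F \<circ> inv_into U z"
    by (rule chart[OF U(1)])
  have "\<phi> \<circ> inv_into U z = (\<lambda>_. c)"
    using c by (simp add: fun_eq_iff)
  then show False
    using nondegenerate[of "z undefined"] U(2) by simp
qed

lemma almost_complex_if_pdy:
  assumes s: "\<sigma> = 1 \<or> \<sigma> = - 1" and J: "\<And>U z p. (U, z) \<in> A \<Longrightarrow> p \<in> z ` U \<Longrightarrow>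
      pdy (\<phi> \<circ> inv_into U z) p = \<sigma> *\<^sub>R cross7 ((\<phi> \<circ> inv_into U z) p) (pdx (\<phi> \<circ> inv_into U z) p)"
  shows "almost_complex_curve A \<phi> \<or> almost_complex_curve (conj_atlas A) \<phi>"
proof -
  have fd: "frechet_derivative (\<phi> \<circ> inv_into U z) (at p) (\<i> * h)
      = \<sigma> *\<^sub>R cross7 ((\<phi> \<circ> inv_into U z) p) (frechet_derivative (\<phi> \<circ> inv_into U z) (at p) h)"
    if U: "(U, z) \<in> A" "p \<in> z ` U" for U z p h
  proof -
    interpret conformal_harmonic_chart_primitive "z ` U" "\<phi> \<circ> inv_into U z" "F \<circ> inv_into U z"
      by (rule chart[OF U(1)])
    show ?thesis
      using s by (intro complex_linear_of_pdy diff[OF U(2)] unit[OF U(2)] g_fd[OF U(2)] J[OF U]) auto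
  qed
  have sm: "smooth_map A \<phi>"
    using immersion by (simp add: immersion_def)
  from s show ?thesis
  proof
    assume "\<sigma> = 1"
    then have "almost_complex_curve A \<phi>"
      using sm norm_\<phi> \<phi>_not_constant fd by (intro almost_complex_curveI) auto
    then show ?thesis ..
  next
    assume s: "\<sigma> = - 1"
    have "everywhere_local A (\<lambda>g p. \<forall>h. frechet_derivative (g \<circ> cnj) (at (cnj p)) (\<i> * h)
      = cross7 ((g \<circ> cnj) (cnj p)) (frechet_derivative (g \<circ> cnj) (at (cnj p)) h)) \<phi>"
      unfolding everywhere_local_def
    proof (clarsimp simp del: comp_apply)
      fix U z x h assume U: "(U, z) \<in> A" "x \<in> U"
      let ?g = "\<phi> \<circ> inv_into U z"
      interpret conformal_harmonic_chart_primitive "z ` U" ?g "F \<circ> inv_into U z"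
        by (rule chart[OF U(1)])
      have p: "z x \<in> z ` U"
        using U by blast
      have c: "frechet_derivative (?g \<circ> cnj) (at (cnj (z x))) k = frechet_derivative ?g (at (z x)) (cnj k)" for k
        using frechet_derivative_compose_cnj(1)[of ?g "cnj (z x)"] diff[OF p] by simp
      have "frechet_derivative ?g (at (z x)) (cnj (\<i> * h)) = - frechet_derivative ?g (at (z x)) (\<i> * cnj h)"
        using linear_neg[OF linear_frechet_derivative[OF diff[OF p]], of "\<i> * cnj h"] by simp
      then show "frechet_derivative (?g \<circ> cnj) (at (cnj (z x))) (\<i> * h)
        = cross7 ((?g \<circ> cnj) (cnj (z x))) (frechet_derivative (?g \<circ> cnj) (at (cnj (z x))) h)"
        unfolding c fd[OF U(1) p] s by simp
    qed
    then have "almost_complex_curve (conj_atlas A) \<phi>"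
      unfolding almost_complex_curve_def everywhere_local_conj_atlas smooth_map_conj_atlas
      using sm norm_\<phi> \<phi>_not_constant by (auto simp: constant_on_def)
    then show ?thesis ..
  qed
qed

text \<open>The constants \<open>C\<close> and \<open>W\<close> are the cosine of the angle between \<open>\<phi>\<close> and the Gauss map \<open>c - F\<close>, and
  their product; the latter provides the axis \<open>v\<close> of the rotation.\<close>

lemma minimal_imp_constant_angle:
  assumes r: "r > 0" and min: "minimal_in_sphere A c r F"
  shows "\<exists>C. \<forall>x. \<phi> x \<bullet> (c - F x) = C" and "\<exists>W. \<forall>x. cross7 (\<phi> x) (c - F x) = W"
    and "(c - F x) \<bullet> (c - F x) = 1"
    and "(U, z) \<in> A \<Longrightarrow> p \<in> z ` U \<Longrightarrow> (c - (F \<circ> inv_into U z) p) \<bullet> pdx (\<phi> \<circ> inv_into U z) p = 0"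
    and "(U, z) \<in> A \<Longrightarrow> p \<in> z ` U \<Longrightarrow> (c - (F \<circ> inv_into U z) p) \<bullet> pdy (\<phi> \<circ> inv_into U z) p = 0"
proof -
  have cross: "cross7 (pdx (\<phi> \<circ> inv_into U z) p) (pdy (\<phi> \<circ> inv_into U z) p)
      = - (pdx (\<phi> \<circ> inv_into U z) p \<bullet> pdx (\<phi> \<circ> inv_into U z) p) *\<^sub>R ((F \<circ> inv_into U z) p - c)"
    if U: "(U, z) \<in> A" "p \<in> z ` U" for U z p
  proof (rule conformal_harmonic_chart_primitive.minimal_F_imp[OF chart[OF U(1)] r _ U(2)])
    have "F x \<in> sphere c r" for x
      using min by (auto simp: minimal_in_sphere_def image_subset_iff)
    then show "norm ((F \<circ> inv_into U z) q - c) = r" for q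
      by (simp add: dist_norm norm_minus_commute)
    show "mean_curvature_vector c (F \<circ> inv_into U z) p = 0"
      using min U by (auto simp: minimal_in_sphere_def everywhere_local_def)
  qed
  note G = conformal_harmonic_chart_primitive.Gauss_map_derivatives[OF chart cross]
  have "((\<lambda>x. \<phi> x \<bullet> (c - F x)) \<circ> inv_into U z has_derivative (\<lambda>h. 0)) (at p)"
    "((\<lambda>x. cross7 (\<phi> x) (c - F x)) \<circ> inv_into U z has_derivative (\<lambda>h. 0)) (at p)"
    if U: "(U, z) \<in> A" "p \<in> z ` U" for U z p
    using G(4,5)[OF U(1) U(1) _ U(2)] by (simp_all add: o_def)
  then show "\<exists>C. \<forall>x. \<phi> x \<bullet> (c - F x) = C" "\<exists>W. \<forall>x. cross7 (\<phi> x) (c - F x) = W"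
    by (auto intro!: constant_if_derivative_0)
  show "(c - F x) \<bullet> (c - F x) = 1"
  proof -
    obtain U z where U: "(U, z) \<in> A" "x \<in> U"
      by (rule chart_at)
    show ?thesis
      using G(1)[OF U(1) U(1) _, of "z x"] U by (simp add: inv_chart[OF U])
  qed
  show "(c - (F \<circ> inv_into U z) p) \<bullet> pdx (\<phi> \<circ> inv_into U z) p = 0"
    "(c - (F \<circ> inv_into U z) p) \<bullet> pdy (\<phi> \<circ> inv_into U z) p = 0"
    if U: "(U, z) \<in> A" "p \<in> z ` U"
    by (rule G(2,3)[OF U(1) U(1) _ U(2)], assumption)+
qed

text \<open>With \<open>F = c - rot7 v \<gamma> \<circ> \<phi>\<close> the definition of \<open>F\<close> becomes \<open>\<phi> \<times> \<phi>\<^sub>x = rot7 v \<gamma> \<phi>\<^sub>y\<close>, and rotating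
  \<open>\<phi>\<close> by \<open>\<gamma> / 3\<close> gives an almost complex curve in the complement of \<open>v\<close>. Either it is full there, or
  \<open>\<phi>\<close> is orthogonal to a second vector \<open>w\<close>, which forces it to be totally geodesic.\<close>

lemma rotated_type_III_or_totally_geodesic:
  assumes v: "norm v = 1" and \<phi>v: "\<And>x. \<phi> x \<bullet> v = 0" and S: "sin \<gamma> \<noteq> 0"
    and F: "\<And>x. F x = c + - rot7 v \<gamma> (\<phi> x)"
    and N: "\<And>U z p. (U, z) \<in> A \<Longrightarrow> p \<in> z ` U \<Longrightarrow> rot7 v \<gamma> ((\<phi> \<circ> inv_into U z) p) \<bullet> pdx (\<phi> \<circ> inv_into U z) p = 0"
      "\<And>U z p. (U, z) \<in> A \<Longrightarrow> p \<in> z ` U \<Longrightarrow> rot7 v \<gamma> ((\<phi> \<circ> inv_into U z) p) \<bullet> pdy (\<phi> \<circ> inv_into U z) p = 0"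
  shows "(\<exists>v \<beta> \<psi>. norm v = 1 \<and> type_III A \<psi> \<and> range \<psi> \<subseteq> sphere 0 1 \<inter> {x. x \<bullet> v = 0} \<and> \<phi> = rot7 v \<beta> \<circ> \<psi>)
      \<or> totally_geodesic_in_sphere A 0 1 \<phi>"
proof -
  \<comment> \<open>The twist \<open>\<gamma>\<close> has to be three times the angle of the rotation.\<close>
  define \<alpha> where "\<alpha> = \<gamma> / 3"
  define \<psi> where "\<psi> = (\<lambda>x. rot7 v \<alpha> (\<phi> x))"
  have \<phi>\<psi>: "\<phi> = rot7 v (- \<alpha>) \<circ> \<psi>"
    using rot7_rot7[OF v \<phi>v, of "- \<alpha>" \<alpha>] by (simp add: fun_eq_iff \<psi>_def rot7_0)
  have norm_rot: "norm (rot7 v b x) = norm x" for b x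
    by (simp add: norm_eq inner_rot7_rot7[OF v])
  have \<psi>v: "\<psi> x \<bullet> v = 0" and \<psi>1: "norm (\<psi> x) = 1" for x
    by (simp_all add: \<psi>_def rot7_inner_axis[OF v] \<phi>v norm_rot norm_\<phi>)
  have twist: "cross7 ((\<phi> \<circ> inv_into U z) p) (pdx (\<phi> \<circ> inv_into U z) p) = rot7 v \<gamma> (pdy (\<phi> \<circ> inv_into U z) p)"
    if U: "(U, z) \<in> A" "p \<in> z ` U" for U z p
  proof -
    interpret conformal_harmonic_chart_primitive "z ` U" "\<phi> \<circ> inv_into U z" "F \<circ> inv_into U z"
      by (rule chart[OF U(1)])
    have "pdy (F \<circ> inv_into U z) p = - rot7 v \<gamma> (pdy (\<phi> \<circ> inv_into U z) p)"
      by (rule F_derivatives_if_linear_image(1)[of c]) (use U in \<open>simp_all add: F bounded_linear_minus bounded_linear_rot7\<close>)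
    then show ?thesis
      by (simp add: F_derivative(3)[OF U(2)])
  qed
  have "almost_complex_curve A \<psi>"
  proof (rule almost_complex_curveI)
    show "smooth_map A \<psi>"
      unfolding smooth_map_def
    proof (clarify)
      fix U z assume U: "(U, z) \<in> A"
      have "smooth_on (\<lambda>q. rot7 v \<alpha> ((\<phi> \<circ> inv_into U z) q)) (z ` U)"
        by (rule smooth_on_bounded_linear[OF chart_image_open[OF U] bounded_linear_rot7])
          (use immersion U in \<open>auto simp: immersion_def smooth_map_def o_def\<close>)
      then show "smooth_on (\<psi> \<circ> inv_into U z) (z ` U)"
        by (simp add: \<psi>_def o_def)
    qed
    show "\<not> (\<forall>x. \<psi> x = c)" for c
      using \<phi>_not_constant[of "rot7 v (- \<alpha>) c"] by (auto simp: \<phi>\<psi>)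
    fix U z p h assume U: "(U, z) \<in> A" "p \<in> z ` U"
    interpret conformal_harmonic_chart_primitive "z ` U" "\<phi> \<circ> inv_into U z" "F \<circ> inv_into U z"
      by (rule chart[OF U(1)])
    have "\<psi> \<circ> inv_into U z = (\<lambda>q. rot7 v \<alpha> ((\<phi> \<circ> inv_into U z) q))"
      by (simp add: \<psi>_def o_def)
    then show "frechet_derivative (\<psi> \<circ> inv_into U z) (at p) (\<i> * h)
      = cross7 ((\<psi> \<circ> inv_into U z) p) (frechet_derivative (\<psi> \<circ> inv_into U z) (at p) h)"
      using untwist_almost_complex[OF v _ _ U(2), of \<alpha> h] twist[OF U(1)] by (simp only: comp_apply \<phi>v) (simp add: \<alpha>_def)
  qed (rule \<psi>1)
  define V where "V = {x. x \<bullet> v = 0}"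
  have V: "subspace V"
    using subspace_hyperplane[of v] by (simp add: V_def inner_commute)
  have "dim V = 6"
    using dim_hyperplane[of v] v by (force simp: V_def inner_commute)
  show ?thesis
  proof (cases "linearly_full_in \<psi> V")
    case True
    then have "type_III A \<psi>"
      using \<open>almost_complex_curve A \<psi>\<close> V \<open>dim V = 6\<close> by (auto simp: type_III_def)
    moreover have "range \<psi> \<subseteq> sphere 0 1 \<inter> {x. x \<bullet> v = 0}"
      using \<psi>v \<psi>1 by auto
    ultimately show ?thesis
      using v \<phi>\<psi> by blast
  next
    case False
    moreover have "range \<psi> \<subseteq> V"
      using \<psi>v by (auto simp: V_def)
    ultimately obtain W where W: "subspace W" "range \<psi> \<subseteq> W" "W \<subset> V"
      by (auto simp: linearly_full_in_def)
    obtain u where u: "u \<noteq> 0" "u \<in> V" "\<And>y. y \<in> W \<Longrightarrow> u \<bullet> y = 0"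
      using orthogonal_to_subspace_exists_gen[of W V] W V
      by (auto simp: span_eq_iff[THEN iffD2] orthogonal_def)
    \<comment> \<open>Rotating back, so that \<open>\<phi> \<bullet> w = \<psi> \<bullet> u\<close>.\<close>
    define w where "w = rot7 v (- \<alpha>) u"
    have w: "w \<noteq> 0" "w \<bullet> v = 0"
      using u norm_rot[of "- \<alpha>" u] by (auto simp: w_def V_def rot7_inner_axis[OF v])
    have \<phi>w: "\<phi> x \<bullet> w = 0" for x
      unfolding w_def \<phi>\<psi> comp_apply inner_rot7_rot7[OF v] using u(3)[of "\<psi> x"] W(2)
      by (auto simp: inner_commute)
    have "everywhere_local A (\<lambda>g p. \<forall>h k. second_fundamental_form 0 g p h k = 0) \<phi>"
      unfolding everywhere_local_def
    proof (clarify)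
      fix U z x h k assume U: "(U, z) \<in> A" "x \<in> U"
      let ?g = "\<phi> \<circ> inv_into U z"
      interpret conformal_harmonic_chart_primitive "z ` U" ?g "F \<circ> inv_into U z"
        by (rule chart[OF U(1)])
      have gv: "?g q \<bullet> v = 0" for q
        by (simp add: \<phi>v)
      have dv: "frechet_derivative ?g (at q) h \<bullet> v = 0" if "q \<in> z ` U" for q h
        using frechet_derivative_eq_0_open[where h = h, OF open_S that gv]
          frechet_derivative_bounded_linear(1)[where h = h, OF bounded_linear_inner_left[of v] diff[OF that]] by simp
      have J1: "cross7 v (?g q) \<bullet> pdx ?g q = 0" "cross7 v (?g q) \<bullet> pdy ?g q = 0" if q: "q \<in> z ` U" for q
        using N[OF U(1) q] S unfolding rot7_orthogonal[OF gv] by (simp_all add: inner_add_left g_fd[OF q, simplified])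
      have J2: "cross7 v (pdx ?g q) \<bullet> pdy ?g q = 0" if q: "q \<in> z ` U" for q
      proof -
        have "rot7 v \<gamma> (pdy ?g q) \<bullet> pdx ?g q = 0"
          unfolding twist[OF U(1) q, symmetric] by simp
        then have "cross7 v (pdy ?g q) \<bullet> pdx ?g q = 0"
          using S unfolding rot7_orthogonal[OF dv[OF q]] by (simp add: inner_add_left orth'[OF q])
        then show ?thesis
          using inner_cross7_swap[of v "pdx ?g q" "pdy ?g q"] by simp
      qed
      have "\<forall>h k. second_fundamental_form 0 ?g (z x) h k = 0"
      proof (rule horizontal_not_full_imp_totally_geodesic[OF _ gv J1 J2 w])
        show "v \<bullet> v = 1"
          using v by (simp add: norm_eq_1)
      qed (use \<phi>w U in auto)
      then show "second_fundamental_form 0 ?g (z x) h k = 0"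
        by blast
    qed
    then have "totally_geodesic_in_sphere A 0 1 \<phi>"
      using immersion norm_\<phi> by (auto simp: totally_geodesic_in_sphere_def)
    then show ?thesis ..
  qed
qed

text \<open>Let \<open>C\<close> be the constant cosine of the angle between the unit vectors \<open>\<phi>\<close> and \<open>c - F\<close>. If \<open>C = \<plusminus>1\<close>
  then \<open>c - F = C \<phi>\<close>, and the definition of \<open>F\<close> becomes the equation of almost complex curves, up to
  orientation. Otherwise the constant vector \<open>\<phi> \<times> (c - F)\<close> is not 0; its direction \<open>v\<close> is orthogonal
  to \<open>\<phi>\<close>, and \<open>c - F\<close> is \<open>\<phi>\<close> rotated about \<open>v\<close> by the angle with cosine \<open>C\<close>.\<close>

lemma minimal_imp_trichotomy:
  assumes r: "r > 0" and min: "minimal_in_sphere A c r F"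
  shows "almost_complex_curve A \<phi> \<or> almost_complex_curve (conj_atlas A) \<phi>
    \<or> (\<exists>v \<beta> \<psi>. norm v = 1 \<and> type_III A \<psi> \<and> range \<psi> \<subseteq> sphere 0 1 \<inter> {x. x \<bullet> v = 0} \<and> \<phi> = rot7 v \<beta> \<circ> \<psi>)
    \<or> totally_geodesic_in_sphere A 0 1 \<phi>"
proof -
  obtain C where C: "\<And>x. \<phi> x \<bullet> (c - F x) = C"
    using minimal_imp_constant_angle(1)[OF r min] by blast
  obtain W where W: "\<And>x. cross7 (\<phi> x) (c - F x) = W"
    using minimal_imp_constant_angle(2)[OF r min] by blast
  note N1 = minimal_imp_constant_angle(3)[OF r min]
  note N = minimal_imp_constant_angle(4,5)[OF r min]
  have \<phi>1: "\<phi> x \<bullet> \<phi> x = 1" for x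
    using norm_\<phi> by (simp add: norm_eq_1)
  have WW: "W \<bullet> W = 1 - C * C"
    using inner_cross7_cross7'[of "\<phi> undefined" "c - F undefined" "c - F undefined"]
    by (simp only: W C N1 \<phi>1)
  show ?thesis
  proof (cases "C * C = 1")
    case True
    have eq: "c - F x = C *\<^sub>R \<phi> x" for x
    proof -
      have "(c - F x - C *\<^sub>R \<phi> x) \<bullet> (c - F x - C *\<^sub>R \<phi> x)
          = (c - F x) \<bullet> (c - F x) - 2 * C * (\<phi> x \<bullet> (c - F x)) + C * C * (\<phi> x \<bullet> \<phi> x)"
        by (simp add: inner_diff_left inner_diff_right inner_commute algebra_simps)
      also have "\<dots> = 0"
        unfolding C N1 \<phi>1 using True by simp
      finally show ?thesis
        by simp
    qed
    have F: "F x = c + - C *\<^sub>R \<phi> x" for x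
      using eq[of x] by (simp add: algebra_simps)
    have "pdy (\<phi> \<circ> inv_into U z) p = C *\<^sub>R cross7 ((\<phi> \<circ> inv_into U z) p) (pdx (\<phi> \<circ> inv_into U z) p)"
      if U: "(U, z) \<in> A" "p \<in> z ` U" for U z p
    proof -
      interpret conformal_harmonic_chart_primitive "z ` U" "\<phi> \<circ> inv_into U z" "F \<circ> inv_into U z"
        by (rule chart[OF U(1)])
      have "pdy (F \<circ> inv_into U z) p = - C *\<^sub>R pdy (\<phi> \<circ> inv_into U z) p"
        by (rule F_derivatives_if_linear_image(1)[where d = c, OF _ bounded_linear_scaleR_right U(2)]) (simp add: F)
      then have "cross7 ((\<phi> \<circ> inv_into U z) p) (pdx (\<phi> \<circ> inv_into U z) p) = C *\<^sub>R pdy (\<phi> \<circ> inv_into U z) p"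
        by (simp add: F_derivative(3)[OF U(2)])
      then show ?thesis
        using True by simp
    qed
    from almost_complex_if_pdy[OF _ this] show ?thesis
      using True by (auto simp: square_eq_1_iff)
  next
    case False
    have "C * C < 1"
      using inner_ge_zero[of W] False by (simp add: WW)
    then have C1: "\<bar>C\<bar> < 1"
      by (metis abs_square_less_1 power2_eq_square)
    define \<gamma> where "\<gamma> = arccos C"
    have cos: "cos \<gamma> = C"
      using C1 by (simp add: \<gamma>_def cos_arccos_abs)
    have sin: "sin \<gamma> = sqrt (1 - C * C)" "sin \<gamma> > 0"
      using C1 \<open>C * C < 1\<close> by (simp_all add: \<gamma>_def sin_arccos_abs power2_eq_square)
    have normW: "norm W = sin \<gamma>"
      by (simp add: norm_eq_sqrt_inner WW sin(1))
    define v where "v = (1 / sin \<gamma>) *\<^sub>R W"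
    have v: "norm v = 1"
      using sin(2) by (simp add: v_def normW)
    have \<phi>v: "\<phi> x \<bullet> v = 0" for x
      by (simp add: v_def W[of x, symmetric])
    have rot: "rot7 v \<gamma> (\<phi> x) = c - F x" for x
    proof -
      have "sin \<gamma> *\<^sub>R cross7 v (\<phi> x) = cross7 W (\<phi> x)"
        using sin(2) by (simp add: v_def cross7.scaleR_left)
      also have "\<dots> = (c - F x) - C *\<^sub>R \<phi> x"
        by (simp only: W[of x, symmetric] cross7_cross7_same_left \<phi>1 C scaleR_one)
      finally show ?thesis
        by (simp add: rot7_orthogonal[OF \<phi>v] cos)
    qed
    have "F x = c + - rot7 v \<gamma> (\<phi> x)" for x
      by (simp add: rot)
    moreover have "sin \<gamma> \<noteq> 0"
      using sin(2) by simp
    ultimately show ?thesis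
      using rotated_type_III_or_totally_geodesic[OF v \<phi>v, of \<gamma> c] N by (simp only: rot comp_apply) blast
  qed
qed

end

theorem theorem2:
  fixes A :: "('a::t2_space) chart set" and \<phi> F :: "'a \<Rightarrow> real^7"
  assumes "riemann_surface A"
    and "immersion A \<phi>"
    and "conformal A \<phi>"
    and "harmonic_into_unit_sphere A \<phi>"
    and "is_cross_star_primitive A \<phi> F"
  shows "(\<exists>c r. r > 0 \<and> minimal_in_sphere A c r F) \<longleftrightarrow>
    (\<exists>B \<in> {A, conj_atlas A}.
        almost_complex_curve B \<phi>
      \<or> (\<exists>v \<beta> \<psi>. norm v = 1 \<and> type_III B \<psi> \<and> range \<psi> \<subseteq> sphere 0 1 \<inter> {x. x \<bullet> v = 0} \<and>
           \<phi> = rot7 v \<beta> \<circ> \<psi>)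
      \<or> totally_geodesic_in_sphere B 0 1 \<phi>)"
    (is "?minimal \<longleftrightarrow> ?cases")
proof -
  interpret riemann_surface A
    by fact
  interpret conformal_harmonic_immersion A \<phi> F
    by unfold_locales fact+
  show ?thesis
  proof
    assume ?minimal
    then show ?cases
      using minimal_imp_trichotomy by blast
  next
    assume ?cases
    then have "\<exists>c. minimal_in_sphere A c 1 F"
    proof (elim bexE disjE exE conjE)
      fix B v \<beta> \<psi>
      assume B: "B \<in> {A, conj_atlas A}" and v: "norm v = 1" and "type_III B \<psi>"
        and "range \<psi> \<subseteq> sphere 0 1 \<inter> {x. x \<bullet> v = 0}" and \<phi>: "\<phi> = rot7 v \<beta> \<circ> \<psi>"
      then have "almost_complex_curve B \<psi>" "\<And>x. \<psi> x \<bullet> v = 0"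
        by (auto simp: type_III_def)
      then show ?thesis
        using B v \<phi> by (intro minimal_if_rotated_almost_complex)
    qed (rule minimal_if_almost_complex minimal_if_totally_geodesic; assumption)+
    then show ?minimal
      using zero_less_one by blast
  qed
qed

end
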